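(* Let $A$ be an operator algebra with a contractive approximate identity. For $a,b \in A$ let $M_{a,b} : A \to A$, $M_{a,b}(x) = axb$. (i) The following are equivalent: $A$ is a hereditary subalgebra (HSA) in its bidual $A^{**}$; $M_{a,b}$ is weakly compact for all $a,b \in A$; $A$ is weakly compact (that is, $M_{a,a}$ is weakly compact for all $a \in A$). (ii) $M_{a,b}$ is compact for all $a,b\in A$ if and only if $A$ is compact (that is, $M_{a,a}$ is compact for all $a \in A$). (iii) If in addition $A$ is commutative, then $A$ is compact (resp. weakly compact) if and only if multiplication by $a$ is a compact (resp. weakly compact) operator on $A$ for all $a \in A$.
   Context: An operator algebra is a norm closed algebra of operators on a complex Hilbert space. The bidual $A^{**}$ is an operator algebra with its (unique) Arens product, with $A \subset A^{**}$ canonically. A hereditary subalgebra (HSA) of an operator algebra $B$ is a norm closed subalgebra $D$ which has a contractive approximate identity and satisfies $DBD \subset D$. So, for $A$ with a contractive approximate identity, $A$ is a HSA in its bidual iff $AA^{**}A \subset A$. *)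

theory Defs
  imports "HOL-Analysis.Analysis" "HOL-Library.Function_Algebras"
begin

class scaleC =
  fixes scaleC :: "complex \<Rightarrow> 'a \<Rightarrow> 'a" (infixr "*\<^sub>C" 75)

class complex_vector = ab_group_add + scaleC +
  assumes scaleC_add_right: "c *\<^sub>C (x + y) = c *\<^sub>C x + c *\<^sub>C y"
    and scaleC_add_left: "(c + d) *\<^sub>C x = c *\<^sub>C x + d *\<^sub>C x"
    and scaleC_scaleC: "c *\<^sub>C (d *\<^sub>C x) = (c * d) *\<^sub>C x"
    and scaleC_one: "1 *\<^sub>C x = x"

class complex_normed_vector = real_normed_vector + complex_vector +
  assumes scaleR_scaleC: "scaleR r x = complex_of_real r *\<^sub>C x"
    and norm_scaleC: "norm (c *\<^sub>C x) = cmod c * norm x"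

class complex_hilbert = complex_normed_vector + banach +
  fixes cinner :: "'a \<Rightarrow> 'a \<Rightarrow> complex"
  assumes cinner_commute: "cinner x y = cnj (cinner y x)"
    and cinner_add_left: "cinner (x + y) z = cinner x z + cinner y z"
    and cinner_scaleC_left: "cinner (c *\<^sub>C x) y = c * cinner x y"
    and norm_eq_sqrt_cinner: "norm x = sqrt (Re (cinner x x))"

instantiation complex :: complex_hilbert
begin

definition scaleC_complex :: "complex \<Rightarrow> complex \<Rightarrow> complex"
  where "scaleC_complex c x = c * x"

definition cinner_complex :: "complex \<Rightarrow> complex \<Rightarrow> complex"
  where "cinner_complex x y = x * cnj y"

instance
proof
  fix c d x y z :: complex and r :: real
  show "c *\<^sub>C (x + y) = c *\<^sub>C x + c *\<^sub>C y" "(c + d) *\<^sub>C x = c *\<^sub>C x + d *\<^sub>C x"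
    "c *\<^sub>C d *\<^sub>C x = (c * d) *\<^sub>C x" "1 *\<^sub>C x = x"
    by (simp_all add: scaleC_complex_def distrib_left distrib_right mult.assoc)
  show "r *\<^sub>R x = complex_of_real r *\<^sub>C x" "norm (c *\<^sub>C x) = cmod c * norm x"
    by (simp_all add: scaleC_complex_def scaleR_conv_of_real norm_mult)
  show "cinner x y = cnj (cinner y x)" "cinner (x + y) z = cinner x z + cinner y z"
    "cinner (c *\<^sub>C x) y = c * cinner x y"
    by (simp_all add: cinner_complex_def scaleC_complex_def algebra_simps)
  show "norm x = sqrt (Re (cinner x x))"
    by (simp add: cinner_complex_def cmod_def power2_eq_square)
qed

end

instantiation "fun" :: (type, complex_vector) complex_vector
begin

definition scaleC_fun :: "complex \<Rightarrow> ('a \<Rightarrow> 'b) \<Rightarrow> 'a \<Rightarrow> 'b"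
  where "scaleC_fun c f = (\<lambda>x. c *\<^sub>C f x)"

instance
  by standard
    (auto simp: scaleC_fun_def fun_eq_iff scaleC_add_right scaleC_add_left scaleC_scaleC scaleC_one)

end

lemma bounded_linear_scaleC_right:
  "bounded_linear (\<lambda>x::'a::complex_normed_vector. c *\<^sub>C x)"
  by (rule bounded_linear_intro[where K = "cmod c"])
    (simp_all add: scaleC_add_right scaleR_scaleC scaleC_scaleC norm_scaleC mult.commute)

lemma norm_blinfun_scaleC:
  fixes f g :: "'a::real_normed_vector \<Rightarrow>\<^sub>L 'b::complex_normed_vector"
  assumes "\<And>x. blinfun_apply g x = c *\<^sub>C blinfun_apply f x"
  shows "norm g = cmod c * norm f"
proof (rule antisym)
  have le: "norm g \<le> cmod c * norm f"
    if "\<And>x. blinfun_apply g x = c *\<^sub>C blinfun_apply f x"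
    for c and f g :: "'a \<Rightarrow>\<^sub>L 'b"
  proof (rule norm_blinfun_bound)
    fix x
    show "norm (blinfun_apply g x) \<le> cmod c * norm f * norm x"
      by (simp add: that norm_scaleC mult.assoc mult_left_mono norm_blinfun)
  qed simp
  show "norm g \<le> cmod c * norm f" by (rule le) (rule assms)
  show "cmod c * norm f \<le> norm g"
  proof (cases "c = 0")
    case False
    have "norm f \<le> cmod (inverse c) * norm g"
      by (rule le) (simp add: assms scaleC_scaleC scaleC_one False)
    then have "norm f \<le> norm g / cmod c"
      by (simp add: norm_inverse divide_inverse mult.commute)
    then show ?thesis
      using False by (simp add: pos_le_divide_eq mult.commute)
  qed simp
qed

instantiation blinfun :: (real_normed_vector, complex_normed_vector) complex_normed_vector
begin

lift_definition scaleC_blinfun :: "complex \<Rightarrow> ('a \<Rightarrow>\<^sub>L 'b) \<Rightarrow> ('a \<Rightarrow>\<^sub>L 'b)"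
  is "\<lambda>c f x. c *\<^sub>C f x"
  by (rule bounded_linear_compose[OF bounded_linear_scaleC_right])

instance
proof
  fix c d :: complex and r :: real and f g :: "'a \<Rightarrow>\<^sub>L 'b"
  show "c *\<^sub>C (f + g) = c *\<^sub>C f + c *\<^sub>C g"
    by transfer (simp add: scaleC_add_right)
  show "(c + d) *\<^sub>C f = c *\<^sub>C f + d *\<^sub>C f"
    by transfer (simp add: scaleC_add_left)
  show "c *\<^sub>C d *\<^sub>C f = (c * d) *\<^sub>C f"
    by transfer (simp add: scaleC_scaleC)
  show "1 *\<^sub>C f = f"
    by transfer (simp add: scaleC_one)
  show "r *\<^sub>R f = complex_of_real r *\<^sub>C f"
    by transfer (simp add: scaleR_scaleC)
  show "norm (c *\<^sub>C f) = cmod c * norm f"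
    by (rule norm_blinfun_scaleC) (simp add: scaleC_blinfun.rep_eq)
qed

end

definition csubspace :: "'v::complex_vector set \<Rightarrow> bool" where
  "csubspace V \<longleftrightarrow>
     0 \<in> V \<and> (\<forall>x\<in>V. \<forall>y\<in>V. x + y \<in> V) \<and> (\<forall>c. \<forall>x\<in>V. c *\<^sub>C x \<in> V)"

definition clinear_on :: "'v::complex_vector set \<Rightarrow> ('v \<Rightarrow> 'w::complex_vector) \<Rightarrow> bool" where
  "clinear_on V f \<longleftrightarrow>
     (\<forall>x\<in>V. \<forall>y\<in>V. f (x + y) = f x + f y) \<and> (\<forall>c. \<forall>x\<in>V. f (c *\<^sub>C x) = c *\<^sub>C f x)"


text \<open>A normed space is a subspace \<open>V\<close> of some type together with a norm \<open>N\<close>;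
  functionals on \<open>V\<close> are represented by functions vanishing outside \<open>V\<close>, so that equality and the
  vector space operations of the dual are those of the function type.\<close>

definition dual_space :: "'v::complex_vector set \<Rightarrow> ('v \<Rightarrow> real) \<Rightarrow> ('v \<Rightarrow> complex) set" where
  "dual_space V N =
     {f. clinear_on V f \<and> (\<exists>K. \<forall>x\<in>V. cmod (f x) \<le> K * N x) \<and> (\<forall>x. x \<notin> V \<longrightarrow> f x = 0)}"

definition dual_norm :: "'v::complex_vector set \<Rightarrow> ('v \<Rightarrow> real) \<Rightarrow> ('v \<Rightarrow> complex) \<Rightarrow> real" where
  "dual_norm V N f = (SUP x\<in>{x \<in> V. N x \<le> 1}. cmod (f x))"

definition bidual ::
    "'v::complex_vector set \<Rightarrow> ('v \<Rightarrow> real) \<Rightarrow> (('v \<Rightarrow> complex) \<Rightarrow> complex) set" where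
  "bidual V N = dual_space (dual_space V N) (dual_norm V N)"

definition bidual_norm ::
    "'v::complex_vector set \<Rightarrow> ('v \<Rightarrow> real) \<Rightarrow> (('v \<Rightarrow> complex) \<Rightarrow> complex) \<Rightarrow> real" where
  "bidual_norm V N = dual_norm (dual_space V N) (dual_norm V N)"

definition canonical_embedding ::
    "'v::complex_vector set \<Rightarrow> ('v \<Rightarrow> real) \<Rightarrow> 'v \<Rightarrow> ('v \<Rightarrow> complex) \<Rightarrow> complex" where
  "canonical_embedding V N x = (\<lambda>\<phi>. if \<phi> \<in> dual_space V N then \<phi> x else 0)"


text \<open>The (first) Arens product on the bidual of a normed algebra \<open>V\<close> with product \<open>m\<close>:
  \<open>(\<phi> \<cdot> a)(x) = \<phi>(a x)\<close>, \<open>(\<eta> \<cdot> \<phi>)(a) = \<eta>(\<phi> \<cdot> a)\<close> and \<open>(\<mu> \<eta>)(\<phi>) = \<mu>(\<eta> \<cdot> \<phi>)\<close>. Operator algebras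
  are Arens regular, so for them the second Arens product is the same.\<close>

definition dual_act ::
    "'v::complex_vector set \<Rightarrow> ('v \<Rightarrow> 'v \<Rightarrow> 'v) \<Rightarrow> ('v \<Rightarrow> complex) \<Rightarrow> 'v \<Rightarrow> ('v \<Rightarrow> complex)" where
  "dual_act V m \<phi> a = (\<lambda>x. if x \<in> V then \<phi> (m a x) else 0)"

definition bidual_act ::
    "'v::complex_vector set \<Rightarrow> ('v \<Rightarrow> 'v \<Rightarrow> 'v) \<Rightarrow> (('v \<Rightarrow> complex) \<Rightarrow> complex)
      \<Rightarrow> ('v \<Rightarrow> complex) \<Rightarrow> ('v \<Rightarrow> complex)" where
  "bidual_act V m \<eta> \<phi> = (\<lambda>a. if a \<in> V then \<eta> (dual_act V m \<phi> a) else 0)"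

definition arens_product ::
    "'v::complex_vector set \<Rightarrow> ('v \<Rightarrow> real) \<Rightarrow> ('v \<Rightarrow> 'v \<Rightarrow> 'v)
      \<Rightarrow> (('v \<Rightarrow> complex) \<Rightarrow> complex) \<Rightarrow> (('v \<Rightarrow> complex) \<Rightarrow> complex)
      \<Rightarrow> (('v \<Rightarrow> complex) \<Rightarrow> complex)" where
  "arens_product V N m \<mu> \<eta> = (\<lambda>\<phi>. if \<phi> \<in> dual_space V N then \<mu> (bidual_act V m \<eta> \<phi>) else 0)"


text \<open>Contractive approximate identities are two-sided. The net is given by its eventuality
  filter on the algebra.\<close>

definition has_cai :: "('v::complex_vector \<Rightarrow> real) \<Rightarrow> ('v \<Rightarrow> 'v \<Rightarrow> 'v) \<Rightarrow> 'v set \<Rightarrow> bool" where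
  "has_cai N m D \<longleftrightarrow>
     (\<exists>F. F \<noteq> bot \<and> (\<forall>\<^sub>F e in F. e \<in> D \<and> N e \<le> 1) \<and>
       (\<forall>a\<in>D. ((\<lambda>e. N (m e a - a)) \<longlongrightarrow> 0) F \<and> ((\<lambda>e. N (m a e - a)) \<longlongrightarrow> 0) F))"

definition hereditary_subalgebra ::
    "('v::complex_vector \<Rightarrow> real) \<Rightarrow> ('v \<Rightarrow> 'v \<Rightarrow> 'v) \<Rightarrow> 'v set \<Rightarrow> 'v set \<Rightarrow> bool" where
  "hereditary_subalgebra N m B D \<longleftrightarrow>
     D \<subseteq> B \<and> csubspace D \<and> (\<forall>x\<in>D. \<forall>y\<in>D. m x y \<in> D) \<and>
     (\<forall>x\<in>B. (\<forall>\<epsilon>>0. \<exists>d\<in>D. N (x - d) < \<epsilon>) \<longrightarrow> x \<in> D) \<and>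
     has_cai N m D \<and>
     (\<forall>x\<in>D. \<forall>b\<in>B. \<forall>y\<in>D. m (m x b) y \<in> D)"

definition bounded_operator_on :: "'v::complex_normed_vector set \<Rightarrow> ('v \<Rightarrow> 'v) \<Rightarrow> bool" where
  "bounded_operator_on V T \<longleftrightarrow>
     T ` V \<subseteq> V \<and> clinear_on V T \<and> (\<exists>K. \<forall>x\<in>V. norm (T x) \<le> K * norm x)"

definition weak_topology_on :: "'v::complex_normed_vector set \<Rightarrow> 'v topology" where
  "weak_topology_on V =
     topology_generated_by {{x \<in> V. \<phi> x \<in> U} | \<phi> U. \<phi> \<in> dual_space V norm \<and> open U}"

definition compact_operator_on :: "'v::complex_normed_vector set \<Rightarrow> ('v \<Rightarrow> 'v) \<Rightarrow> bool" where
  "compact_operator_on V T \<longleftrightarrow>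
     bounded_operator_on V T \<and>
     compactin (top_of_set V) (top_of_set V closure_of (T ` {x \<in> V. norm x \<le> 1}))"

definition weakly_compact_operator_on :: "'v::complex_normed_vector set \<Rightarrow> ('v \<Rightarrow> 'v) \<Rightarrow> bool" where
  "weakly_compact_operator_on V T \<longleftrightarrow>
     bounded_operator_on V T \<and>
     compactin (weak_topology_on V) (weak_topology_on V closure_of (T ` {x \<in> V. norm x \<le> 1}))"


text \<open>Elements of the type \<open>'h \<Rightarrow>\<^sub>L 'h\<close> are only real-linear, whence the complex linearity condition;
  the real and complex operator norms agree.\<close>

definition operator_algebra :: "('h::complex_hilbert \<Rightarrow>\<^sub>L 'h) set \<Rightarrow> bool" where
  "operator_algebra A \<longleftrightarrow>
     (\<forall>a\<in>A. clinear_on UNIV (blinfun_apply a)) \<and>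
     csubspace A \<and> (\<forall>a\<in>A. \<forall>b\<in>A. a o\<^sub>L b \<in> A) \<and> closed A"

definition two_sided_mult ::
    "('h::complex_hilbert \<Rightarrow>\<^sub>L 'h) \<Rightarrow> ('h \<Rightarrow>\<^sub>L 'h) \<Rightarrow> ('h \<Rightarrow>\<^sub>L 'h) \<Rightarrow> ('h \<Rightarrow>\<^sub>L 'h)" where
  "two_sided_mult a b x = a o\<^sub>L x o\<^sub>L b"

definition compact_algebra :: "('h::complex_hilbert \<Rightarrow>\<^sub>L 'h) set \<Rightarrow> bool" where
  "compact_algebra A \<longleftrightarrow> (\<forall>a\<in>A. compact_operator_on A (two_sided_mult a a))"

definition weakly_compact_algebra :: "('h::complex_hilbert \<Rightarrow>\<^sub>L 'h) set \<Rightarrow> bool" where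
  "weakly_compact_algebra A \<longleftrightarrow> (\<forall>a\<in>A. weakly_compact_operator_on A (two_sided_mult a a))"

definition HSA_in_bidual :: "('h::complex_hilbert \<Rightarrow>\<^sub>L 'h) set \<Rightarrow> bool" where
  "HSA_in_bidual A \<longleftrightarrow>
     hereditary_subalgebra (bidual_norm A norm) (arens_product A norm (o\<^sub>L))
       (bidual A norm) (canonical_embedding A norm ` A)"

end

theory Submission
  imports Defs
begin

text \<open>
  By Gantmacher's theorem, an operator \<open>T\<close> is weakly compact iff \<open>T\<^sup>*\<^sup>*\<close> maps \<open>A\<^sup>*\<^sup>*\<close> into \<open>A\<close>. Since
  \<open>M\<^bsub>a,b\<^esub>\<^sup>*\<^sup>* \<eta> = a \<eta> b\<close> for the Arens product, \<open>A A\<^sup>*\<^sup>* A \<subseteq> A\<close> says precisely that all \<open>M\<^bsub>a,b\<^esub>\<close> are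
  weakly compact. The compact and the weakly compact operators are both closed under norm limits
  and under composition with bounded operators on the left. With \<open>e\<close> running through the
  approximate identity, \<open>M\<^bsub>a,b\<^esub>\<close> is the norm limit of \<open>M\<^bsub>a,b\<^esub> M\<^bsub>e,e\<^esub>\<close>, and in the commutative case
  multiplication by \<open>a\<close> is the norm limit of \<open>M\<^bsub>e,a\<^esub>\<close>, while \<open>M\<^bsub>a,a\<^esub>\<close> is multiplication by \<open>a\<^sup>2\<close>.
\<close>

section \<open>Dual spaces and dual norms\<close>

lemma csubspace_0: "csubspace V \<Longrightarrow> 0 \<in> V"
  and csubspace_add: "csubspace V \<Longrightarrow> x \<in> V \<Longrightarrow> y \<in> V \<Longrightarrow> x + y \<in> V"
  and csubspace_scale: "csubspace V \<Longrightarrow> x \<in> V \<Longrightarrow> c *\<^sub>C x \<in> V"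
  by (auto simp: csubspace_def)

lemma scaleC_zero_left: "0 *\<^sub>C x = (0::'a::complex_vector)"
  using scaleC_add_left[of 0 0 x] by simp

lemma scaleC_minus_one: "(-1) *\<^sub>C x = - (x::'a::complex_vector)"
proof -
  have "x + (-1) *\<^sub>C x = 0"
    using scaleC_add_left[of 1 "-1" x] by (simp add: scaleC_one scaleC_zero_left)
  then show ?thesis
    by (metis add.inverse_unique)
qed

lemma csubspace_minus: "csubspace V \<Longrightarrow> x \<in> V \<Longrightarrow> - x \<in> V"
  by (metis csubspace_scale scaleC_minus_one)

lemma csubspace_diff: "csubspace V \<Longrightarrow> x \<in> V \<Longrightarrow> y \<in> V \<Longrightarrow> x - y \<in> V"
  by (metis csubspace_add csubspace_minus diff_conv_add_uminus)

lemma clinear_on_add: "clinear_on V f \<Longrightarrow> x \<in> V \<Longrightarrow> y \<in> V \<Longrightarrow> f (x + y) = f x + f y"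
  and clinear_on_scale: "clinear_on V f \<Longrightarrow> x \<in> V \<Longrightarrow> f (c *\<^sub>C x) = c *\<^sub>C f x"
  by (auto simp: clinear_on_def)

lemma clinear_on_0: "csubspace V \<Longrightarrow> clinear_on V f \<Longrightarrow> f 0 = 0"
  by (metis clinear_on_scale csubspace_0 scaleC_zero_left)

lemma clinear_on_diff:
  assumes "csubspace V" "clinear_on V f" "x \<in> V" "y \<in> V"
  shows "f (x - y) = f x - f y"
proof -
  have "f (x + (-1) *\<^sub>C y) = f x + (-1) *\<^sub>C f y"
    using assms by (metis clinear_on_add clinear_on_scale csubspace_scale)
  then show ?thesis
    by (simp add: scaleC_minus_one)
qed

lemma clinear_on_sum:
  assumes V: "csubspace V" and f: "clinear_on V f" and "finite I" "\<And>i. i \<in> I \<Longrightarrow> g i \<in> V"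
  shows "(\<Sum>i\<in>I. c i *\<^sub>C g i) \<in> V \<and> f (\<Sum>i\<in>I. c i *\<^sub>C g i) = (\<Sum>i\<in>I. c i *\<^sub>C f (g i))"
  using assms(3,4)
proof (induction I rule: finite_induct)
  case empty
  then show ?case
    using V f by (simp add: csubspace_0 clinear_on_0)
next
  case (insert i I)
  then have "g i \<in> V" "(\<Sum>i\<in>I. c i *\<^sub>C g i) \<in> V"
    "f (\<Sum>i\<in>I. c i *\<^sub>C g i) = (\<Sum>i\<in>I. c i *\<^sub>C f (g i))"
    by auto
  then show ?case
    using insert.hyps V f
    by (simp add: csubspace_add csubspace_scale clinear_on_add clinear_on_scale)
qed

lemma clinear_on_eval: "clinear_on W (\<lambda>f. f x)"
  by (simp add: clinear_on_def scaleC_fun_def)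


section \<open>Dual spaces of spaces with a homogeneous size function\<close>

lemma dual_space_clinear: "f \<in> dual_space V N \<Longrightarrow> clinear_on V f"
  and dual_space_outside: "f \<in> dual_space V N \<Longrightarrow> x \<notin> V \<Longrightarrow> f x = 0"
  by (auto simp: dual_space_def)

text \<open>The interface is weak enough to hold both for \<open>V\<close> with \<open>norm\<close>
  and for its dual with \<open>dual_norm\<close>, so that one set of lemmas, used twice, also covers
  the bidual. \<open>N\<close> may vanish at nonzero vectors.\<close>

locale homogeneous_space =
  fixes V :: "'v::complex_vector set" and N :: "'v \<Rightarrow> real"
  assumes csubspace: "csubspace V"
    and nonneg: "x \<in> V \<Longrightarrow> 0 \<le> N x"
    and homogeneous: "x \<in> V \<Longrightarrow> N (c *\<^sub>C x) \<le> cmod c * N x"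
begin

lemma N_0: "N 0 = 0"
  using homogeneous[of 0 0] nonneg[of 0] csubspace_0[OF csubspace] by (simp add: scaleC_zero_left)

lemma dual_space_bound:
  assumes "f \<in> dual_space V N"
  obtains K where "K \<ge> 0" "\<And>x. x \<in> V \<Longrightarrow> cmod (f x) \<le> K * N x"
proof -
  obtain K where K: "\<And>x. x \<in> V \<Longrightarrow> cmod (f x) \<le> K * N x"
    using assms by (auto simp: dual_space_def)
  have "cmod (f x) \<le> max K 0 * N x" if "x \<in> V" for x
    using K[OF that] nonneg[OF that] by (meson max.cobounded1 mult_right_mono order_trans)
  then show thesis
    by (intro that[of "max K 0"]) auto
qed

text \<open>A supremum of reals bounds its members only when the set is bounded above; the bound
  \<open>K\<close> of the functional provides this.\<close>

lemma dual_norm_upper: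
  assumes f: "f \<in> dual_space V N" and x: "x \<in> V" "N x \<le> 1"
  shows "cmod (f x) \<le> dual_norm V N f"
proof -
  obtain K where K: "K \<ge> 0" "\<And>x. x \<in> V \<Longrightarrow> cmod (f x) \<le> K * N x"
    using dual_space_bound[OF f] by blast
  have "cmod (f y) \<le> K" if "y \<in> V" "N y \<le> 1" for y
    using K(2)[OF that(1)] mult_left_mono[OF that(2) K(1)] by simp
  then show ?thesis
    unfolding dual_norm_def using x by (intro cSUP_upper) (auto intro!: bdd_aboveI2)
qed

lemma dual_norm_nonneg: "f \<in> dual_space V N \<Longrightarrow> 0 \<le> dual_norm V N f"
  using dual_norm_upper[of f 0] csubspace_0[OF csubspace] N_0 by (smt (verit) norm_ge_zero)

lemma dual_norm_least:
  assumes "\<And>x. x \<in> V \<Longrightarrow> N x \<le> 1 \<Longrightarrow> cmod (f x) \<le> K"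
  shows "dual_norm V N f \<le> K"
  unfolding dual_norm_def
  using assms csubspace_0[OF csubspace] N_0 by (intro cSUP_least) force+

text \<open>Rescaling \<open>x\<close> to size at most 1 reduces this to
  \<open>dual_norm_upper\<close>. Where \<open>N x\<close> is 0 no rescaling is possible, but there
  any bound on \<open>f\<close> forces \<open>f x\<close> to be 0.\<close>

lemma dual_norm_bound:
  assumes f: "f \<in> dual_space V N" and x: "x \<in> V"
  shows "cmod (f x) \<le> dual_norm V N f * N x"
proof (cases "N x = 0")
  case True
  then show ?thesis
    using dual_space_bound[OF f] x by (metis mult_zero_right)
next
  case False
  then have pos: "N x > 0"
    using nonneg[OF x] by simp
  let ?y = "complex_of_real (inverse (N x)) *\<^sub>C x"
  have y: "?y \<in> V"
    by (rule csubspace_scale[OF csubspace x])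
  have "N ?y \<le> 1"
    using homogeneous[OF x, of "complex_of_real (inverse (N x))"] pos
    by (simp add: norm_inverse)
  then have "cmod (f ?y) \<le> dual_norm V N f"
    using dual_norm_upper[OF f y] by simp
  also have "f ?y = complex_of_real (inverse (N x)) * f x"
    using clinear_on_scale[OF dual_space_clinear[OF f] x] by (simp add: scaleC_complex_def)
  finally have "cmod (f x / complex_of_real (N x)) \<le> dual_norm V N f"
    by (simp add: divide_inverse mult.commute)
  then show ?thesis
    using pos by (simp add: norm_divide field_simps)
qed

lemma csubspace_dual_space: "csubspace (dual_space V N)"
  unfolding csubspace_def
proof (intro conjI ballI allI)
  show "0 \<in> dual_space V N"
    by (auto simp: dual_space_def clinear_on_def scaleC_complex_def intro!: exI[of _ 0])
next
  fix f g assume f: "f \<in> dual_space V N" and g: "g \<in> dual_space V N"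
  obtain K where K: "\<And>x. x \<in> V \<Longrightarrow> cmod (f x) \<le> K * N x"
    using dual_space_bound[OF f] by blast
  obtain L where L: "\<And>x. x \<in> V \<Longrightarrow> cmod (g x) \<le> L * N x"
    using dual_space_bound[OF g] by blast
  have "cmod (f x + g x) \<le> (K + L) * N x" if "x \<in> V" for x
    using norm_triangle_le[of "f x" "g x"] K[OF that] L[OF that] by (simp add: algebra_simps)
  moreover have "clinear_on V (f + g)"
    using dual_space_clinear[OF f] dual_space_clinear[OF g]
    by (simp add: clinear_on_def scaleC_complex_def algebra_simps)
  ultimately show "f + g \<in> dual_space V N"
    using f g by (auto simp: dual_space_def)
next
  fix c f assume f: "f \<in> dual_space V N"
  obtain K where K: "\<And>x. x \<in> V \<Longrightarrow> cmod (f x) \<le> K * N x"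
    using dual_space_bound[OF f] by blast
  have "cmod (c * f x) \<le> (cmod c * K) * N x" if "x \<in> V" for x
    using mult_left_mono[OF K[OF that], of "cmod c"] by (simp add: norm_mult mult.assoc)
  moreover have "clinear_on V (c *\<^sub>C f)"
    using dual_space_clinear[OF f]
    by (simp add: clinear_on_def scaleC_complex_def scaleC_fun_def algebra_simps)
  ultimately show "c *\<^sub>C f \<in> dual_space V N"
    using f by (auto simp: dual_space_def scaleC_fun_def scaleC_complex_def)
qed

lemma homogeneous_dual_space: "homogeneous_space (dual_space V N) (dual_norm V N)"
proof
  fix c f assume f: "f \<in> dual_space V N"
  show "dual_norm V N (c *\<^sub>C f) \<le> cmod c * dual_norm V N f"
    by (rule dual_norm_least)
      (simp add: scaleC_fun_def scaleC_complex_def norm_mult dual_norm_upper[OF f] mult_left_mono)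
qed (simp_all add: csubspace_dual_space dual_norm_nonneg)

end

section \<open>Goldstine's theorem and weakly compact operators\<close>

text \<open>The assumption \<open>norming\<close> stands in for Hahn-Banach: the functionals in the
  dual determine the norm. Since the ambient type is a Banach space, closedness of \<open>V\<close>
  makes \<open>V\<close> complete.\<close>

locale norming_subspace =
  fixes V :: "'v::{complex_normed_vector, banach} set"
  assumes csubspace_V: "csubspace V"
    and closed_V: "closed V"
    and norming: "\<lbrakk>x \<in> V; K \<ge> 0; \<And>\<phi>. \<phi> \<in> dual_space V norm \<Longrightarrow> cmod (\<phi> x) \<le> K * dual_norm V norm \<phi>\<rbrakk>
      \<Longrightarrow> norm x \<le> K"
begin

sublocale V: homogeneous_space V norm
  by standard (simp_all add: csubspace_V norm_scaleC)

abbreviation "V' \<equiv> dual_space V norm"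
abbreviation "N' \<equiv> dual_norm V norm"
abbreviation "V'' \<equiv> bidual V norm"
abbreviation "N'' \<equiv> bidual_norm V norm"
abbreviation "emb \<equiv> canonical_embedding V norm"

sublocale V': homogeneous_space V' N'
  by (rule V.homogeneous_dual_space)

text \<open>The bidual is by definition the dual of \<open>V'\<close>, so the general facts about
  duals are restated under the names of the bidual.\<close>

lemmas csubspace_bidual = V'.csubspace_dual_space[folded bidual_def]
lemmas bidual_norm_bound = V'.dual_norm_bound[folded bidual_def bidual_norm_def]
lemmas bidual_norm_least = V'.dual_norm_least[folded bidual_norm_def]
lemmas bidual_clinear = dual_space_clinear[of _ V' N', folded bidual_def]
lemmas bidual_outside = dual_space_outside[of _ V' N', folded bidual_def]

section \<open>The canonical embedding into the bidual\<close>

lemma bidualI: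
  assumes "clinear_on V' \<eta>" "\<And>\<phi>. \<phi> \<in> V' \<Longrightarrow> cmod (\<eta> \<phi>) \<le> K * N' \<phi>" "\<And>\<phi>. \<phi> \<notin> V' \<Longrightarrow> \<eta> \<phi> = 0"
  shows "\<eta> \<in> V''"
  using assms unfolding bidual_def dual_space_def[of V' N'] by blast

lemma emb_apply: "\<phi> \<in> V' \<Longrightarrow> emb x \<phi> = \<phi> x"
  by (simp add: canonical_embedding_def)

lemma emb_in_bidual:
  assumes "x \<in> V"
  shows "emb x \<in> V''"
proof (rule bidualI)
  show "clinear_on V' (emb x)"
    unfolding clinear_on_def
  proof (intro conjI ballI allI)
    fix \<phi> \<psi> assume "\<phi> \<in> V'" "\<psi> \<in> V'"
    then show "emb x (\<phi> + \<psi>) = emb x \<phi> + emb x \<psi>"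
      using csubspace_add[OF V.csubspace_dual_space] by (simp add: emb_apply)
  next
    fix c \<phi> assume "\<phi> \<in> V'"
    then show "emb x (c *\<^sub>C \<phi>) = c *\<^sub>C emb x \<phi>"
      using csubspace_scale[OF V.csubspace_dual_space, of \<phi> c] by (simp add: emb_apply scaleC_fun_def)
  qed
  show "cmod (emb x \<phi>) \<le> norm x * N' \<phi>" if "\<phi> \<in> V'" for \<phi>
    using V.dual_norm_bound[OF that assms] that by (simp add: emb_apply mult.commute)
qed (simp add: canonical_embedding_def)

lemma norm_emb_le:
  assumes x: "x \<in> V"
  shows "N'' (emb x) \<le> norm x"
proof (rule bidual_norm_least)
  fix \<phi> assume "\<phi> \<in> V'" "N' \<phi> \<le> 1"
  then show "cmod (emb x \<phi>) \<le> norm x"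
    using V.dual_norm_bound[of \<phi> x] x mult_right_mono[of "N' \<phi>" 1 "norm x"] by (simp add: emb_apply)
qed

lemma emb_add: "x \<in> V \<Longrightarrow> y \<in> V \<Longrightarrow> emb (x + y) = emb x + emb y"
  by (auto simp: canonical_embedding_def fun_eq_iff clinear_on_add[OF dual_space_clinear])

lemma emb_scale: "x \<in> V \<Longrightarrow> emb (c *\<^sub>C x) = c *\<^sub>C emb x"
  by (auto simp: canonical_embedding_def fun_eq_iff scaleC_fun_def scaleC_complex_def
      clinear_on_scale[OF dual_space_clinear])

lemma emb_diff: "x \<in> V \<Longrightarrow> y \<in> V \<Longrightarrow> emb (x - y) = emb x - emb y"
  by (auto simp: canonical_embedding_def fun_eq_iff clinear_on_diff[OF csubspace_V] dual_space_clinear)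

lemma separating:
  assumes "x \<in> V" "y \<in> V" "\<And>\<phi>. \<phi> \<in> V' \<Longrightarrow> \<phi> x = \<phi> y"
  shows "x = y"
proof -
  have "\<phi> (x - y) = 0" if "\<phi> \<in> V'" for \<phi>
    using assms that by (simp add: clinear_on_diff[OF csubspace_V dual_space_clinear])
  then have "norm (x - y) \<le> 0"
    by (intro norming csubspace_diff csubspace_V assms) simp_all
  then show ?thesis
    by simp
qed

lemma csubspace_range_emb: "csubspace (emb ` V)"
  unfolding csubspace_def
proof (intro conjI ballI allI)
  show "0 \<in> emb ` V"
    by (rule image_eqI[of _ _ 0])
      (auto simp: csubspace_0[OF csubspace_V] canonical_embedding_def fun_eq_iff
        clinear_on_0[OF csubspace_V dual_space_clinear])
qed (auto simp: emb_add[symmetric] emb_scale[symmetric] csubspace_add csubspace_scale csubspace_V)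

text \<open>Vectors \<open>a n\<close> whose images approximate \<eta> form a Cauchy sequence,
  because \<open>norming\<close> turns bounds on functionals into bounds on the norm. Completeness
  gives a limit in \<open>V\<close>, and \<eta> is its image.\<close>

lemma range_emb_closed:
  assumes \<eta>: "\<eta> \<in> V''" and approx: "\<And>\<epsilon>. \<epsilon> > 0 \<Longrightarrow> \<exists>d\<in>emb ` V. N'' (\<eta> - d) < \<epsilon>"
  shows "\<eta> \<in> emb ` V"
proof -
  have "\<exists>a\<in>V. N'' (\<eta> - emb a) < inverse (real (Suc n))" for n
    using approx[of "inverse (real (Suc n))"] by auto
  then obtain a where aV: "\<And>n. a n \<in> V"
    and a: "\<And>n. N'' (\<eta> - emb (a n)) < inverse (real (Suc n))"
    by metis
  have bound: "cmod (\<eta> \<phi> - \<phi> (a n)) \<le> inverse (real (Suc n)) * N' \<phi>" if "\<phi> \<in> V'" for \<phi> n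
  proof -
    have "\<eta> - emb (a n) \<in> V''"
      by (intro csubspace_diff csubspace_bidual \<eta> emb_in_bidual aV)
    from bidual_norm_bound[OF this that] show ?thesis
      using mult_right_mono[OF less_imp_le[OF a[of n]] V.dual_norm_nonneg[OF that]] that
      by (simp add: canonical_embedding_def)
  qed
  have diff: "norm (a m - a n) \<le> inverse (real (Suc m)) + inverse (real (Suc n))" for m n
  proof (rule norming)
    fix \<phi> assume \<phi>: "\<phi> \<in> V'"
    have "\<phi> (a m - a n) = (\<eta> \<phi> - \<phi> (a n)) - (\<eta> \<phi> - \<phi> (a m))"
      by (simp add: clinear_on_diff[OF csubspace_V dual_space_clinear[OF \<phi>]] aV)
    then show "cmod (\<phi> (a m - a n)) \<le> (inverse (real (Suc m)) + inverse (real (Suc n))) * N' \<phi>"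
      using norm_triangle_ineq4[of "\<eta> \<phi> - \<phi> (a n)" "\<eta> \<phi> - \<phi> (a m)"] bound[OF \<phi>, of n] bound[OF \<phi>, of m]
      by (simp add: distrib_right)
  qed (simp_all add: csubspace_diff csubspace_V aV)
  have "Cauchy a"
  proof (rule metric_CauchyI)
    fix \<epsilon> :: real assume "\<epsilon> > 0"
    then obtain M where M: "inverse (real (Suc M)) < \<epsilon> / 2"
      using reals_Archimedean[of "\<epsilon> / 2"] by auto
    have "dist (a m) (a n) < \<epsilon>" if "m \<ge> M" "n \<ge> M" for m n
    proof -
      have "inverse (real (Suc m)) \<le> inverse (real (Suc M))" "inverse (real (Suc n)) \<le> inverse (real (Suc M))"
        using that by (auto intro!: le_imp_inverse_le)
      then show ?thesis
        using diff[of m n] M unfolding dist_norm by linarith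
    qed
    then show "\<exists>M. \<forall>m\<ge>M. \<forall>n\<ge>M. dist (a m) (a n) < \<epsilon>"
      by blast
  qed
  then obtain x where lim: "a \<longlonglongrightarrow> x"
    using Cauchy_convergent convergentD by blast
  have xV: "x \<in> V"
    using closed_sequentially[OF closed_V] aV lim by blast
  \<comment> \<open>Both \<eta> and evaluation at \<open>x\<close> are compared with evaluation at
    \<open>a n\<close>; the two errors tend to 0.\<close>
  have "\<eta> \<phi> = \<phi> x" if \<phi>: "\<phi> \<in> V'" for \<phi>
  proof -
    have "(\<lambda>n. inverse (real (Suc n)) * N' \<phi> + N' \<phi> * norm (a n - x)) \<longlonglongrightarrow> 0 * N' \<phi> + N' \<phi> * 0"
      using lim by (intro tendsto_intros LIMSEQ_inverse_real_of_nat) (simp add: LIM_zero tendsto_norm_zero)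
    moreover have "cmod (\<eta> \<phi> - \<phi> x) \<le> inverse (real (Suc n)) * N' \<phi> + N' \<phi> * norm (a n - x)" for n
      using norm_triangle_ineq[of "\<eta> \<phi> - \<phi> (a n)" "\<phi> (a n) - \<phi> x"] bound[OF \<phi>, of n]
        V.dual_norm_bound[OF \<phi> csubspace_diff[OF csubspace_V aV xV], of n]
      by (simp add: clinear_on_diff[OF csubspace_V dual_space_clinear[OF \<phi>]] aV xV)
    ultimately have "cmod (\<eta> \<phi> - \<phi> x) \<le> 0"
      by (intro LIMSEQ_le_const) auto
    then show ?thesis
      by simp
  qed
  then have "\<eta> = emb x"
    using bidual_outside[OF \<eta>] by (auto simp: canonical_embedding_def fun_eq_iff)
  then show ?thesis
    using xV by blast
qed

section \<open>Bounded operators and their transposes\<close>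

definition transpose_on :: "('v \<Rightarrow> 'v) \<Rightarrow> ('v \<Rightarrow> complex) \<Rightarrow> 'v \<Rightarrow> complex" where
  "transpose_on T \<phi> = (\<lambda>x. if x \<in> V then \<phi> (T x) else 0)"

text \<open>With \<open>transpose_on\<close> these are the adjoints \<open>T*\<close> and
  \<open>T**\<close> of Banach space theory. The values 0 off \<open>V\<close> and off
  \<open>V'\<close> keep them within the representation of functionals as functions vanishing
  outside their domain.\<close>

definition bitranspose_on ::
    "('v \<Rightarrow> 'v) \<Rightarrow> (('v \<Rightarrow> complex) \<Rightarrow> complex) \<Rightarrow> ('v \<Rightarrow> complex) \<Rightarrow> complex" where
  "bitranspose_on T \<eta> = (\<lambda>\<phi>. if \<phi> \<in> V' then \<eta> (transpose_on T \<phi>) else 0)"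

lemma bounded_operatorE:
  assumes "bounded_operator_on V T"
  obtains K where "K \<ge> 0" "\<And>x. x \<in> V \<Longrightarrow> norm (T x) \<le> K * norm x"
proof -
  obtain K where K: "\<And>x. x \<in> V \<Longrightarrow> norm (T x) \<le> K * norm x"
    using assms by (auto simp: bounded_operator_on_def)
  have "norm (T x) \<le> max K 0 * norm x" if "x \<in> V" for x
    using K[OF that] by (meson max.cobounded1 mult_right_mono norm_ge_zero order_trans)
  then show thesis
    by (intro that[of "max K 0"]) auto
qed

lemma bounded_operator_in: "bounded_operator_on V T \<Longrightarrow> x \<in> V \<Longrightarrow> T x \<in> V"
  and bounded_operator_clinear: "bounded_operator_on V T \<Longrightarrow> clinear_on V T"
  by (auto simp: bounded_operator_on_def)

lemma bounded_operator_compose: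
  assumes S: "bounded_operator_on V S" and T: "bounded_operator_on V T"
  shows "bounded_operator_on V (\<lambda>x. S (T x))"
proof -
  obtain K where K: "K \<ge> 0" "\<And>x. x \<in> V \<Longrightarrow> norm (S x) \<le> K * norm x"
    using bounded_operatorE[OF S] by blast
  obtain L where L: "\<And>x. x \<in> V \<Longrightarrow> norm (T x) \<le> L * norm x"
    using bounded_operatorE[OF T] by blast
  have "norm (S (T x)) \<le> (K * L) * norm x" if "x \<in> V" for x
    using K(2)[OF bounded_operator_in[OF T that]] mult_left_mono[OF L[OF that] K(1)]
    by (simp add: mult.assoc)
  then show ?thesis
    using S T unfolding bounded_operator_on_def clinear_on_def
    by (auto simp: image_subset_iff)
qed

lemma bounded_operator_dist:
  assumes T: "bounded_operator_on V T" and S: "bounded_operator_on V S"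
    and le: "\<And>x. x \<in> V \<Longrightarrow> norm (T x - S x) \<le> K * norm x"
    and \<phi>: "\<phi> \<in> V'" and x: "x \<in> V"
  shows "cmod (\<phi> (T x) - \<phi> (S x)) \<le> K * N' \<phi> * norm x"
proof -
  have "\<phi> (T x) - \<phi> (S x) = \<phi> (T x - S x)"
    using T S x
    by (simp add: clinear_on_diff[OF csubspace_V dual_space_clinear[OF \<phi>]] bounded_operator_in)
  also have "cmod \<dots> \<le> N' \<phi> * norm (T x - S x)"
    by (intro V.dual_norm_bound \<phi> csubspace_diff csubspace_V bounded_operator_in[OF T x]
        bounded_operator_in[OF S x])
  also have "\<dots> \<le> N' \<phi> * (K * norm x)"
    by (intro mult_left_mono le x V.dual_norm_nonneg \<phi>)
  finally show ?thesis
    by (simp add: mult_ac)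
qed

lemma transpose_in_dual:
  assumes T: "bounded_operator_on V T" and \<phi>: "\<phi> \<in> V'"
  shows "transpose_on T \<phi> \<in> V'"
proof -
  obtain K where K: "K \<ge> 0" "\<And>x. x \<in> V \<Longrightarrow> norm (T x) \<le> K * norm x"
    using bounded_operatorE[OF T] by blast
  have "cmod (\<phi> (T x)) \<le> (N' \<phi> * K) * norm x" if "x \<in> V" for x
    using V.dual_norm_bound[OF \<phi> bounded_operator_in[OF T that]]
      mult_left_mono[OF K(2)[OF that] V.dual_norm_nonneg[OF \<phi>]] by (simp add: mult.assoc)
  moreover have "clinear_on V (transpose_on T \<phi>)"
    using bounded_operator_clinear[OF T] dual_space_clinear[OF \<phi>] bounded_operator_in[OF T] csubspace_V
    by (simp add: clinear_on_def transpose_on_def csubspace_add csubspace_scale)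
  ultimately show ?thesis
    by (auto simp: dual_space_def transpose_on_def)
qed

lemma transpose_linear:
  "transpose_on T (\<phi> + \<psi>) = transpose_on T \<phi> + transpose_on T \<psi>"
  "transpose_on T (c *\<^sub>C \<phi>) = c *\<^sub>C transpose_on T \<phi>"
  by (auto simp: transpose_on_def fun_eq_iff scaleC_fun_def scaleC_complex_def)

lemma transpose_norm_le:
  assumes K: "K \<ge> 0" "\<And>x. x \<in> V \<Longrightarrow> norm (T x) \<le> K * norm x"
    and T: "bounded_operator_on V T" and \<phi>: "\<phi> \<in> V'"
  shows "N' (transpose_on T \<phi>) \<le> K * N' \<phi>"
proof (rule V.dual_norm_least)
  fix x assume x: "x \<in> V" "norm x \<le> 1"
  have "cmod (\<phi> (T x)) \<le> N' \<phi> * norm (T x)"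
    by (rule V.dual_norm_bound[OF \<phi> bounded_operator_in[OF T x(1)]])
  also have "\<dots> \<le> N' \<phi> * K"
    using K(2)[OF x(1)] mult_left_mono[OF x(2) K(1)]
    by (intro mult_left_mono V.dual_norm_nonneg \<phi>) simp
  finally show "cmod (transpose_on T \<phi> x) \<le> K * N' \<phi>"
    using x by (simp add: transpose_on_def mult.commute)
qed

lemma bitranspose_in_bidual:
  assumes T: "bounded_operator_on V T" and \<eta>: "\<eta> \<in> V''"
  shows "bitranspose_on T \<eta> \<in> V''"
proof -
  obtain K where K: "K \<ge> 0" "\<And>x. x \<in> V \<Longrightarrow> norm (T x) \<le> K * norm x"
    using bounded_operatorE[OF T] by blast
  obtain L where L: "L \<ge> 0" "\<And>\<phi>. \<phi> \<in> V' \<Longrightarrow> cmod (\<eta> \<phi>) \<le> L * N' \<phi>"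
    using V'.dual_space_bound[of \<eta>] \<eta> unfolding bidual_def by blast
  show ?thesis
  proof (rule bidualI)
    show "clinear_on V' (bitranspose_on T \<eta>)"
      using bidual_clinear[OF \<eta>] transpose_in_dual[OF T] V.csubspace_dual_space
      by (simp add: clinear_on_def bitranspose_on_def transpose_linear csubspace_add csubspace_scale)
    fix \<phi> assume \<phi>: "\<phi> \<in> V'"
    have "cmod (\<eta> (transpose_on T \<phi>)) \<le> L * (K * N' \<phi>)"
      using L(2)[OF transpose_in_dual[OF T \<phi>]] mult_left_mono[OF transpose_norm_le[OF K T \<phi>] L(1)]
      by simp
    then show "cmod (bitranspose_on T \<eta> \<phi>) \<le> (L * K) * N' \<phi>"
      using \<phi> by (simp add: bitranspose_on_def mult.assoc)
  qed (simp add: bitranspose_on_def)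
qed

text \<open>A vector almost minimising the distance of the values of the
  functionals in \<open>I\<close> to those of \<open>\<eta>\<close> would otherwise yield a combination \<open>\<theta>\<close> of these functionals
  with \<open>\<parallel>\<theta>\<parallel> < \<bar>\<eta> \<theta>\<bar>\<close>.\<close>

lemma Goldstine:
  assumes \<eta>: "\<eta> \<in> V''" and ball: "\<And>\<phi>. \<phi> \<in> V' \<Longrightarrow> cmod (\<eta> \<phi>) \<le> N' \<phi>"
    and I: "finite I" "I \<subseteq> V'" and \<epsilon>: "\<epsilon> > 0"
  shows "\<exists>x\<in>V. norm x \<le> 1 \<and> (\<forall>\<psi>\<in>I. cmod (\<psi> x - \<eta> \<psi>) < \<epsilon>)"
proof (rule ccontr)
  assume neg: "\<not> ?thesis"
  define B where "B = {x \<in> V. norm x \<le> 1}"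
  define D where "D x = (\<Sum>\<psi>\<in>I. (cmod (\<psi> x - \<eta> \<psi>))\<^sup>2)" for x
  define d where "d = (INF x\<in>B. D x)"
  \<comment> \<open>\<open>M\<close> bounds the sum of the squares of
    \<open>cmod (\<psi> t - \<psi> s)\<close> for any two vectors \<open>s\<close>, \<open>t\<close>
    of the unit ball.\<close>
  define M where "M = (\<Sum>\<psi>\<in>I. (2 * N' \<psi>)\<^sup>2)"
  have lin: "clinear_on V \<psi>" if "\<psi> \<in> I" for \<psi>
    using that I dual_space_clinear by blast
  have B0: "0 \<in> B"
    by (simp add: B_def csubspace_0 csubspace_V)
  have D_ge: "\<epsilon>\<^sup>2 \<le> D x" if "x \<in> B" for x
  proof -
    obtain \<psi> where \<psi>: "\<psi> \<in> I" "cmod (\<psi> x - \<eta> \<psi>) \<ge> \<epsilon>"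
      using neg \<open>x \<in> B\<close> by (force simp: B_def)
    have "\<epsilon>\<^sup>2 \<le> (cmod (\<psi> x - \<eta> \<psi>))\<^sup>2"
      using \<psi>(2) \<epsilon> by (intro power_mono) auto
    also have "\<dots> \<le> D x"
      unfolding D_def using I(1) \<psi>(1) by (intro member_le_sum) auto
    finally show ?thesis .
  qed
  have d_pos: "d > 0"
  proof -
    have "\<epsilon>\<^sup>2 \<le> d"
      unfolding d_def using B0 D_ge by (intro cINF_greatest) auto
    then show ?thesis
      using \<epsilon> by (smt (verit) zero_less_power)
  qed
  have d_le: "d \<le> D x" if "x \<in> B" for x
    unfolding d_def using that D_ge by (intro cINF_lower) (auto intro!: bdd_belowI2)
  have M: "M \<ge> 0"
    by (simp add: M_def sum_nonneg)
  \<comment> \<open>\<open>l\<close> is the length of a step from \<open>s\<close> towards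
    \<open>t\<close>. At most 1, it keeps the new point in the ball; and
    \<open>l * (1 + M) \<le> d\<close> makes the quadratic remainder and the slack in the choice of
    \<open>s\<close> together cost at most \<open>l * d\<close>.\<close>
  define l where "l = min 1 (d / (1 + M))"
  have l: "0 < l" "l \<le> 1"
    using d_pos M by (auto simp: l_def)
  have lM: "l * (1 + M) \<le> d"
    using mult_right_mono[of l "d / (1 + M)" "1 + M"] M by (simp add: l_def)
  \<comment> \<open>The infimum need not be attained, so \<open>s\<close> attains it up to the
    square of \<open>l\<close>, the order of the quadratic remainder.\<close>
  obtain s where s: "s \<in> B" "D s < d + l\<^sup>2"
  proof -
    have "\<exists>s\<in>B. D s < d + l\<^sup>2"
      using cInf_lessD[of "D ` B" "d + l\<^sup>2"] B0 l by (auto simp: d_def)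
    then show thesis
      using that by blast
  qed
  \<comment> \<open>With these coefficients, \<open>Re (\<theta> v)\<close> is minus half the
    derivative of \<open>D\<close> at \<open>s\<close> in direction \<open>v\<close>. As
    \<open>s\<close> is nearly minimal, \<open>Re \<theta>\<close> can hardly grow from
    \<open>s\<close> to another point of the ball.\<close>
  define c where "c \<psi> = - cnj (\<psi> s - \<eta> \<psi>)" for \<psi>
  define \<theta> where "\<theta> = (\<Sum>\<psi>\<in>I. c \<psi> *\<^sub>C \<psi>)"
  have \<theta>: "\<theta> \<in> V'" and \<eta>\<theta>: "\<eta> \<theta> = (\<Sum>\<psi>\<in>I. c \<psi> * \<eta> \<psi>)"
    using clinear_on_sum[OF V.csubspace_dual_space bidual_clinear[OF \<eta>] I(1), of "\<lambda>\<psi>. \<psi>" c] I(2)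
    by (auto simp: \<theta>_def scaleC_complex_def)
  have \<theta>_apply: "\<theta> x = (\<Sum>\<psi>\<in>I. c \<psi> * \<psi> x)" for x
    using clinear_on_sum[OF V.csubspace_dual_space clinear_on_eval I(1), of "\<lambda>\<psi>. \<psi>" c x] I(2)
    by (auto simp: \<theta>_def scaleC_complex_def)
  have Re_\<theta>: "Re (\<theta> t) \<le> Re (\<eta> \<theta>) - d / 2" if t: "t \<in> B" for t
  proof -
    \<comment> \<open>Near minimality is tested at the convex combination \<open>y\<close>;
      expanding \<open>D y\<close> in \<open>l\<close> isolates the linear term in \<theta>.\<close>
    define y where "y = complex_of_real (1 - l) *\<^sub>C s + complex_of_real l *\<^sub>C t"
    have V: "s \<in> V" "t \<in> V" "norm s \<le> 1" "norm t \<le> 1"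
      using s t by (auto simp: B_def)
    have "norm y \<le> (1 - l) * norm s + l * norm t"
      unfolding y_def using l by (intro order_trans[OF norm_triangle_ineq]) (simp add: norm_scaleC del: of_real_diff)
    also have "\<dots> \<le> (1 - l) * 1 + l * 1"
      using V l by (intro add_mono mult_left_mono) auto
    finally have yB: "y \<in> B"
      using V by (simp add: B_def y_def csubspace_add csubspace_scale csubspace_V)
    have \<psi>y: "\<psi> y - \<eta> \<psi> = (\<psi> s - \<eta> \<psi>) + complex_of_real l * (\<psi> t - \<psi> s)" if "\<psi> \<in> I" for \<psi>
      using lin[OF that] V
      by (simp add: y_def clinear_on_add clinear_on_scale csubspace_scale csubspace_V
          scaleC_complex_def algebra_simps)
    have sq: "(cmod (u + of_real l * v))\<^sup>2 = (cmod u)\<^sup>2 + 2 * l * Re (cnj u * v) + l\<^sup>2 * (cmod v)\<^sup>2" for u v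
      by (simp only: cmod_power2) (simp add: power2_eq_square algebra_simps)
    have "d \<le> D y"
      by (rule d_le[OF yB])
    also have "D y = (\<Sum>\<psi>\<in>I. (cmod (\<psi> s - \<eta> \<psi>))\<^sup>2 + 2 * l * Re (cnj (\<psi> s - \<eta> \<psi>) * (\<psi> t - \<psi> s))
        + l\<^sup>2 * (cmod (\<psi> t - \<psi> s))\<^sup>2)"
      unfolding D_def using \<psi>y by (intro sum.cong) (simp_all only: sq)
    also have "\<dots> = D s - 2 * l * (Re (\<theta> t) - Re (\<theta> s)) + l\<^sup>2 * (\<Sum>\<psi>\<in>I. (cmod (\<psi> t - \<psi> s))\<^sup>2)"
      unfolding \<theta>_apply c_def D_def
      by (simp add: sum.distrib sum_distrib_left sum_subtractf sum_negf algebra_simps)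
    also have "\<dots> \<le> D s - 2 * l * (Re (\<theta> t) - Re (\<theta> s)) + l\<^sup>2 * M"
    proof -
      have "(cmod (\<psi> t - \<psi> s))\<^sup>2 \<le> (2 * N' \<psi>)\<^sup>2" if "\<psi> \<in> I" for \<psi>
        using V.dual_norm_upper[of \<psi> t] V.dual_norm_upper[of \<psi> s] V that I
          norm_triangle_ineq4[of "\<psi> t" "\<psi> s"]
        by (intro power_mono) force+
      then have "(\<Sum>\<psi>\<in>I. (cmod (\<psi> t - \<psi> s))\<^sup>2) \<le> M"
        unfolding M_def by (rule sum_mono)
      then show ?thesis
        by (simp add: mult_left_mono)
    qed
    finally have "2 * l * (Re (\<theta> t) - Re (\<theta> s)) \<le> l * (l * (1 + M))"
      using s(2) by (simp add: power2_eq_square algebra_simps)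
    then have "2 * (Re (\<theta> t) - Re (\<theta> s)) \<le> l * (1 + M)"
      using l(1) by (simp add: mult.left_commute)
    then have "Re (\<theta> t) \<le> Re (\<theta> s) + d / 2"
      using lM by simp
    moreover have "Re (\<theta> s) = Re (\<eta> \<theta>) - D s"
    proof -
      have "\<theta> s - \<eta> \<theta> = (\<Sum>\<psi>\<in>I. c \<psi> * (\<psi> s - \<eta> \<psi>))"
        unfolding \<theta>_apply \<eta>\<theta> by (simp add: sum_subtractf algebra_simps)
      also have "\<dots> = (\<Sum>\<psi>\<in>I. - complex_of_real ((cmod (\<psi> s - \<eta> \<psi>))\<^sup>2))"
        unfolding c_def by (intro sum.cong refl) (simp only: complex_norm_square, simp add: algebra_simps)
      finally show ?thesis
        unfolding D_def by (simp add: complex_eq_iff sum_negf)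
    qed
    ultimately show ?thesis
      using d_le[OF s(1)] by simp
  qed
  have "N' \<theta> \<le> Re (\<eta> \<theta>) - d / 2"
  proof (rule V.dual_norm_least)
    fix x assume x: "x \<in> V" "norm x \<le> 1"
    \<comment> \<open>The unimodular \<open>w\<close> rotates \<open>\<theta> x\<close> onto the
      nonnegative reals, so that the bound on the real part becomes a bound on the modulus. The
      value 1 serves when \<open>\<theta> x\<close> is 0.\<close>
    define w where "w = (if \<theta> x = 0 then 1 else cnj (\<theta> x) / cmod (\<theta> x))"
    have "cmod w = 1"
      by (simp add: w_def norm_divide)
    then have "w *\<^sub>C x \<in> B"
      using x by (simp add: B_def csubspace_scale csubspace_V norm_scaleC)
    from Re_\<theta>[OF this] have "Re (w * \<theta> x) \<le> Re (\<eta> \<theta>) - d / 2"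
      using x by (simp add: clinear_on_scale[OF dual_space_clinear[OF \<theta>]] scaleC_complex_def)
    moreover have "w * \<theta> x = complex_of_real (cmod (\<theta> x))"
    proof (cases "\<theta> x = 0")
      case False
      then show ?thesis
        using complex_norm_square[of "\<theta> x"] by (simp add: w_def field_simps power2_eq_square)
    qed simp
    ultimately show "cmod (\<theta> x) \<le> Re (\<eta> \<theta>) - d / 2"
      by simp
  qed
  then show False
    using ball[OF \<theta>] complex_Re_le_cmod[of "\<eta> \<theta>"] d_pos by linarith
qed


section \<open>Weak-star compactness of the bidual ball\<close>

definition bidual_ball :: "(('v \<Rightarrow> complex) \<Rightarrow> complex) set" where
  "bidual_ball = {\<eta> \<in> V''. \<forall>\<phi>\<in>V'. cmod (\<eta> \<phi>) \<le> N' \<phi>}"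

text \<open>This form suits Tychonoff's theorem: pointwise linear equations inside a product of
  discs. Radius 0 at indices outside \<open>V'\<close> encodes vanishing there.\<close>

lemma bidual_ball_eq:
  "bidual_ball = {\<eta>. (\<forall>\<phi>\<in>V'. \<forall>\<psi>\<in>V'. \<eta> (\<phi> + \<psi>) = \<eta> \<phi> + \<eta> \<psi>) \<and> (\<forall>c. \<forall>\<phi>\<in>V'. \<eta> (c *\<^sub>C \<phi>) = c * \<eta> \<phi>)}
     \<inter> (\<Pi>\<^sub>E \<phi>\<in>UNIV. cball 0 (if \<phi> \<in> V' then N' \<phi> else 0))" (is "_ = ?R")
proof (intro set_eqI iffI)
  fix \<eta> assume "\<eta> \<in> bidual_ball"
  then show "\<eta> \<in> ?R"
    using bidual_clinear[of \<eta>] bidual_outside[of \<eta>]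
    by (auto simp: bidual_ball_def clinear_on_def scaleC_complex_def)
next
  fix \<eta> assume \<eta>: "\<eta> \<in> ?R"
  then have le: "cmod (\<eta> \<phi>) \<le> (if \<phi> \<in> V' then N' \<phi> else 0)" for \<phi>
    by (auto simp: PiE_iff)
  have "\<eta> \<in> V''"
  proof (rule bidualI[where K = 1])
    show "clinear_on V' \<eta>"
      using \<eta> by (simp add: clinear_on_def scaleC_complex_def)
    show "cmod (\<eta> \<phi>) \<le> 1 * N' \<phi>" if "\<phi> \<in> V'" for \<phi>
      using le[of \<phi>] that by simp
    show "\<eta> \<phi> = 0" if "\<phi> \<notin> V'" for \<phi>
      using le[of \<phi>] that by simp
  qed
  moreover have "cmod (\<eta> \<phi>) \<le> N' \<phi>" if "\<phi> \<in> V'" for \<phi>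
    using le[of \<phi>] that by simp
  ultimately show "\<eta> \<in> bidual_ball"
    by (simp add: bidual_ball_def)
qed

text \<open>The topology of the function type is that of pointwise convergence, which on the ball is
  the weak-star topology. The product of discs is compact, and each linearity equation involves only
  finitely many coordinates, hence is a closed condition.\<close>

lemma Banach_Alaoglu: "compact bidual_ball"
  unfolding bidual_ball_eq
proof (rule closed_Int_compact)
  have coord: "continuous_on UNIV (\<lambda>\<eta>::('v \<Rightarrow> complex) \<Rightarrow> complex. \<eta> \<phi>)" for \<phi>
    by (rule continuous_on_product_coordinates)
  show "closed {\<eta>. (\<forall>\<phi>\<in>V'. \<forall>\<psi>\<in>V'. \<eta> (\<phi> + \<psi>) = \<eta> \<phi> + \<eta> \<psi>) \<and>
      (\<forall>c. \<forall>\<phi>\<in>V'. \<eta> (c *\<^sub>C \<phi>) = c * \<eta> \<phi>)}"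
    unfolding Ball_def
    by (intro closed_Collect_conj closed_Collect_all closed_Collect_imp closed_Collect_eq
        open_Collect_const coord continuous_intros)
  have "compactin (product_topology (\<lambda>\<phi>. euclidean) UNIV)
      (\<Pi>\<^sub>E \<phi>\<in>UNIV. cball (0::complex) (if \<phi> \<in> V' then N' \<phi> else 0))"
    by (simp add: compactin_PiE)
  then show "compact (\<Pi>\<^sub>E \<phi>\<in>UNIV. cball (0::complex) (if \<phi> \<in> V' then N' \<phi> else 0))"
    by (simp add: euclidean_product_topology)
qed

section \<open>The weak topology\<close>

lemma topspace_weak_topology: "topspace (weak_topology_on V) = V"
proof -
  \<comment> \<open>The zero functional with the whole plane exhibits \<open>V\<close> itself as a
    generating open set.\<close>
  have "V = {x \<in> V. (0::'v \<Rightarrow> complex) x \<in> UNIV}"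
    by simp
  then have "V \<in> {{x \<in> V. \<phi> x \<in> U} | \<phi> U. \<phi> \<in> V' \<and> open U}"
    using csubspace_0[OF V.csubspace_dual_space] open_UNIV by blast
  then show ?thesis
    unfolding weak_topology_on_def topology_generated_by_topspace by auto
qed

lemma openin_weak_topology:
  "\<phi> \<in> V' \<Longrightarrow> open U \<Longrightarrow> openin (weak_topology_on V) {x \<in> V. \<phi> x \<in> U}"
  unfolding weak_topology_on_def by (rule topology_generated_by_Basis) blast

lemma Hausdorff_weak_topology: "Hausdorff_space (weak_topology_on V)"
  unfolding Hausdorff_space_def topspace_weak_topology
proof (intro allI impI)
  fix x y assume xy: "x \<in> V \<and> y \<in> V \<and> x \<noteq> y"
  then obtain \<phi> where \<phi>: "\<phi> \<in> V'" "\<phi> x \<noteq> \<phi> y"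
    using separating by blast
  obtain S T where ST: "open S" "open T" "\<phi> x \<in> S" "\<phi> y \<in> T" "S \<inter> T = {}"
    using hausdorff[OF \<phi>(2)] by blast
  then show "\<exists>S T. openin (weak_topology_on V) S \<and> openin (weak_topology_on V) T \<and>
      x \<in> S \<and> y \<in> T \<and> disjnt S T"
    using xy openin_weak_topology[OF \<phi>(1), of S] openin_weak_topology[OF \<phi>(1), of T]
    by (intro exI[of _ "{x \<in> V. \<phi> x \<in> S}"] exI[of _ "{x \<in> V. \<phi> x \<in> T}"])
      (auto simp: disjnt_def)
qed

section \<open>Gantmacher's theorem\<close>

lemma emb_unit_ball: "x \<in> V \<Longrightarrow> norm x \<le> 1 \<Longrightarrow> emb x \<in> bidual_ball"
  using V.dual_norm_upper by (simp add: bidual_ball_def emb_in_bidual emb_apply)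

lemma bitranspose_emb:
  "bounded_operator_on V T \<Longrightarrow> x \<in> V \<Longrightarrow> bitranspose_on T (emb x) = emb (T x)"
  using transpose_in_dual
  by (auto simp: bitranspose_on_def fun_eq_iff canonical_embedding_def transpose_on_def)

text \<open>Under the range condition \<open>T**\<close>, read as a map \<open>g\<close> into
  \<open>V\<close>, is continuous from the weak-star to the weak topology, since \<phi> after
  \<open>g\<close> is evaluation at \<open>T* \<phi>\<close>. The image of the compact bidual ball
  is thus weakly compact; it contains the image of the unit ball and, being closed in a Hausdorff
  space, also its weak closure.\<close>

lemma weakly_compact_if_bitranspose_range:
  assumes T: "bounded_operator_on V T" and range: "\<And>\<eta>. \<eta> \<in> V'' \<Longrightarrow> bitranspose_on T \<eta> \<in> emb ` V"
  shows "weakly_compact_operator_on V T"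
proof -
  have "\<exists>y\<in>V. bitranspose_on T \<eta> = emb y" if "\<eta> \<in> bidual_ball" for \<eta>
    using range[of \<eta>] that by (auto simp: bidual_ball_def)
  then obtain g where g: "\<And>\<eta>. \<eta> \<in> bidual_ball \<Longrightarrow> g \<eta> \<in> V \<and> bitranspose_on T \<eta> = emb (g \<eta>)"
    by metis
  have g_apply: "\<phi> (g \<eta>) = \<eta> (transpose_on T \<phi>)" if "\<eta> \<in> bidual_ball" "\<phi> \<in> V'" for \<eta> \<phi>
    using g[OF that(1)] that(2) by (metis bitranspose_on_def emb_apply)
  have "continuous_map (top_of_set bidual_ball) (weak_topology_on V) g"
    unfolding weak_topology_on_def
  proof (rule continuous_on_generated_topo)
    fix W assume "W \<in> {{x \<in> V. \<phi> x \<in> U} | \<phi> U. \<phi> \<in> V' \<and> open U}"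
    then obtain \<phi> U where W: "W = {x \<in> V. \<phi> x \<in> U}" "\<phi> \<in> V'" "open U"
      by blast
    have "g -` W \<inter> topspace (top_of_set bidual_ball) =
        bidual_ball \<inter> (\<lambda>\<eta>. \<eta> (transpose_on T \<phi>)) -` U"
      using g g_apply[OF _ W(2)] by (auto simp: W(1))
    also have "openin (top_of_set bidual_ball) \<dots>"
      using W(3) continuous_on_product_coordinates
      by (intro openin_open_Int open_vimage)
    finally show "openin (top_of_set bidual_ball) (g -` W \<inter> topspace (top_of_set bidual_ball))" .
  next
    show "g ` topspace (top_of_set bidual_ball) \<subseteq> \<Union> {{x \<in> V. \<phi> x \<in> U} | \<phi> U. \<phi> \<in> V' \<and> open U}"
      using g topspace_weak_topology unfolding weak_topology_on_def topology_generated_by_topspace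
      by auto
  qed
  then have K: "compactin (weak_topology_on V) (g ` bidual_ball)"
    using Banach_Alaoglu by (intro image_compactin) auto
  have "T ` {x \<in> V. norm x \<le> 1} \<subseteq> g ` bidual_ball"
  proof clarify
    fix x assume x: "x \<in> V" "norm x \<le> 1"
    let ?y = "g (emb x)"
    have y: "?y \<in> V" "emb (T x) = emb ?y"
      using g[OF emb_unit_ball[OF x]] bitranspose_emb[OF T x(1)] by auto
    have "T x = ?y"
    proof (rule separating)
      show "\<phi> (T x) = \<phi> ?y" if "\<phi> \<in> V'" for \<phi>
        using y(2) that by (metis emb_apply)
    qed (use y bounded_operator_in[OF T x(1)] in auto)
    then show "T x \<in> g ` bidual_ball"
      using emb_unit_ball[OF x] by blast
  qed
  then have "weak_topology_on V closure_of (T ` {x \<in> V. norm x \<le> 1}) \<subseteq> g ` bidual_ball"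
    by (intro closure_of_minimal compactin_imp_closedin Hausdorff_weak_topology K)
  then show ?thesis
    unfolding weakly_compact_operator_on_def
    using T K closed_compactin[OF K] by simp
qed

text \<open>If \<open>T\<^sup>*\<^sup>* \<eta>\<close> lay outside the weakly compact set \<open>C\<close>, finitely many functionals would separate it
  from \<open>C\<close>, contradicting Goldstine's theorem.\<close>

lemma bitranspose_ball_if_weakly_compact:
  assumes T: "weakly_compact_operator_on V T" and \<eta>: "\<eta> \<in> bidual_ball"
  shows "bitranspose_on T \<eta> \<in> emb ` V"
proof (rule ccontr)
  assume neg: "bitranspose_on T \<eta> \<notin> emb ` V"
  define C where "C = weak_topology_on V closure_of (T ` {x \<in> V. norm x \<le> 1})"
  have bT: "bounded_operator_on V T" and C: "compactin (weak_topology_on V) C"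
    using T by (auto simp: weakly_compact_operator_on_def C_def)
  have CV: "C \<subseteq> V"
    using compactin_subset_topspace[OF C] by (simp add: topspace_weak_topology)
  have TC: "T x \<in> C" if "x \<in> V" "norm x \<le> 1" for x
  proof -
    have "T ` {x \<in> V. norm x \<le> 1} \<subseteq> C"
      unfolding C_def using bounded_operator_in[OF bT]
      by (intro closure_of_subset) (auto simp: topspace_weak_topology)
    then show ?thesis
      using that by blast
  qed
  \<comment> \<open>Each \<open>k\<close> in \<open>C\<close> is told apart from
    \<open>T** \<eta>\<close> by some functional, as otherwise \<open>T** \<eta>\<close> would be
    \<open>emb k\<close>.\<close>
  have "\<exists>\<phi>\<in>V'. \<phi> k \<noteq> \<eta> (transpose_on T \<phi>)" if "k \<in> C" for k
  proof (rule ccontr)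
    assume "\<not> ?thesis"
    then have "bitranspose_on T \<eta> = emb k"
      by (auto simp: bitranspose_on_def canonical_embedding_def fun_eq_iff)
    then show False
      using neg CV that by blast
  qed
  then obtain f where f: "\<And>k. k \<in> C \<Longrightarrow> f k \<in> V'"
    and fk: "\<And>k. k \<in> C \<Longrightarrow> f k k \<noteq> \<eta> (transpose_on T (f k))"
    by metis
  \<comment> \<open>Half the gap: two errors below \<open>r k\<close> cannot add up to the full
    gap.\<close>
  define r where "r k = cmod (f k k - \<eta> (transpose_on T (f k))) / 2" for k
  have r: "r k > 0" if "k \<in> C" for k
    using fk[OF that] by (simp add: r_def)
  define U where "U k = {x \<in> V. f k x \<in> ball (f k k) (r k)}" for k
  have "\<exists>F. finite F \<and> F \<subseteq> U ` C \<and> C \<subseteq> \<Union>F"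
  proof -
    have "openin (weak_topology_on V) (U k)" if "k \<in> C" for k
      unfolding U_def by (intro openin_weak_topology f that open_ball)
    moreover have "C \<subseteq> \<Union>(U ` C)"
      using CV r by (auto simp: U_def)
    ultimately show ?thesis
      using C unfolding compactin_def by (metis (no_types, lifting) imageE)
  qed
  then obtain J where J: "finite J" "J \<subseteq> C" "C \<subseteq> \<Union>(U ` J)"
    by (metis finite_subset_image)
  have "J \<noteq> {}"
    using J(3) TC[of 0] csubspace_0[OF csubspace_V] by auto
  define \<epsilon> where "\<epsilon> = Min (r ` J)"
  have \<epsilon>: "\<epsilon> > 0" and \<epsilon>_le: "\<And>k. k \<in> J \<Longrightarrow> \<epsilon> \<le> r k"
    using J r \<open>J \<noteq> {}\<close> by (auto simp: \<epsilon>_def)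
  \<comment> \<open>Goldstine's theorem is applied to the transposed functionals, whose values at
    \<open>x\<close> are the values of \<open>f k\<close> at \<open>T x\<close>.\<close>
  have "\<exists>x\<in>V. norm x \<le> 1 \<and> (\<forall>\<psi>\<in>(\<lambda>k. transpose_on T (f k)) ` J. cmod (\<psi> x - \<eta> \<psi>) < \<epsilon>)"
    using \<eta> J f transpose_in_dual[OF bT] \<epsilon> by (intro Goldstine) (auto simp: bidual_ball_def)
  then obtain x where x: "x \<in> V" "norm x \<le> 1"
    and close: "\<And>k. k \<in> J \<Longrightarrow> cmod (f k (T x) - \<eta> (transpose_on T (f k))) < \<epsilon>"
    by (auto simp: transpose_on_def)
  obtain k where k: "k \<in> J" "T x \<in> U k"
    using TC[OF x] J(3) by blast
  have "cmod (f k k - f k (T x)) < r k"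
    using k(2) by (simp add: U_def dist_norm)
  moreover have "cmod (f k (T x) - \<eta> (transpose_on T (f k))) < r k"
    using close[OF k(1)] \<epsilon>_le[OF k(1)] by simp
  ultimately have "cmod (f k k - \<eta> (transpose_on T (f k))) < 2 * r k"
    using norm_triangle_ineq[of "f k k - f k (T x)" "f k (T x) - \<eta> (transpose_on T (f k))"] by simp
  then show False
    by (simp add: r_def)
qed

lemma bitranspose_scale: "bitranspose_on T (c *\<^sub>C \<eta>) = c *\<^sub>C bitranspose_on T \<eta>"
  by (auto simp: bitranspose_on_def fun_eq_iff scaleC_fun_def scaleC_complex_def)

theorem Gantmacher:
  assumes T: "bounded_operator_on V T"
  shows "weakly_compact_operator_on V T \<longleftrightarrow> (\<forall>\<eta>\<in>V''. bitranspose_on T \<eta> \<in> emb ` V)"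
proof (intro iffI ballI)
  fix \<eta> assume wc: "weakly_compact_operator_on V T" and \<eta>: "\<eta> \<in> V''"
  obtain L where L: "L \<ge> 0" "\<And>\<phi>. \<phi> \<in> V' \<Longrightarrow> cmod (\<eta> \<phi>) \<le> L * N' \<phi>"
    using V'.dual_space_bound[of \<eta>] \<eta> unfolding bidual_def by blast
  \<comment> \<open>Scaling by \<open>L + 1\<close> brings \<eta> into the ball; adding 1 keeps
    \<open>c\<close> invertible when \<open>L\<close> is 0.\<close>
  define c where "c = complex_of_real (L + 1)"
  have c: "c \<noteq> 0" "cmod c = L + 1"
    unfolding c_def using L(1) by (simp_all only: of_real_eq_0_iff norm_of_real)
  have "inverse c *\<^sub>C \<eta> \<in> bidual_ball"
  proof -
    have "cmod (\<eta> \<phi>) \<le> N' \<phi> * (L + 1)" if "\<phi> \<in> V'" for \<phi>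
      using L(2)[OF that] V.dual_norm_nonneg[OF that] by (simp add: algebra_simps)
    then have "inverse (L + 1) * cmod (\<eta> \<phi>) \<le> N' \<phi>" if "\<phi> \<in> V'" for \<phi>
      using that L(1) by (simp add: field_simps)
    then show ?thesis
      using csubspace_scale[OF csubspace_bidual \<eta>, of "inverse c"] c(2)
      by (simp add: bidual_ball_def scaleC_fun_def scaleC_complex_def norm_mult norm_inverse)
  qed
  from bitranspose_ball_if_weakly_compact[OF wc this]
  have "c *\<^sub>C bitranspose_on T (inverse c *\<^sub>C \<eta>) \<in> emb ` V"
    by (rule csubspace_scale[OF csubspace_range_emb])
  then show "bitranspose_on T \<eta> \<in> emb ` V"
    using c(1) by (simp add: bitranspose_scale scaleC_scaleC scaleC_one)
qed (use T weakly_compact_if_bitranspose_range in blast)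

section \<open>Norm limits and composition of weakly compact operators\<close>

text \<open>If \<open>S\<close> is close to \<open>T\<close> in norm, then \<open>S** \<eta>\<close>
  is close to \<open>T** \<eta>\<close>. So \<open>T** \<eta>\<close> is a norm limit of elements of
  the range of \<open>emb\<close>, which is closed.\<close>

lemma weakly_compact_limit:
  assumes T: "bounded_operator_on V T"
    and approx: "\<And>\<epsilon>. \<epsilon> > 0 \<Longrightarrow>
      \<exists>S. weakly_compact_operator_on V S \<and> (\<forall>x\<in>V. norm (T x - S x) \<le> \<epsilon> * norm x)"
  shows "weakly_compact_operator_on V T"
  unfolding Gantmacher[OF T]
proof
  fix \<eta> assume \<eta>: "\<eta> \<in> V''"
  obtain L where L: "L \<ge> 0" "\<And>\<phi>. \<phi> \<in> V' \<Longrightarrow> cmod (\<eta> \<phi>) \<le> L * N' \<phi>"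
    using V'.dual_space_bound[of \<eta>] \<eta> unfolding bidual_def by blast
  show "bitranspose_on T \<eta> \<in> emb ` V"
  proof (rule range_emb_closed[OF bitranspose_in_bidual[OF T \<eta>]])
    fix \<epsilon> :: real assume \<epsilon>: "\<epsilon> > 0"
    define \<delta> where "\<delta> = \<epsilon> / (L + 1)"
    have \<delta>: "\<delta> > 0" "L * \<delta> < \<epsilon>"
      using \<epsilon> L(1) by (auto simp: \<delta>_def field_simps)
    obtain S where wc: "weakly_compact_operator_on V S"
      and S: "\<And>x. x \<in> V \<Longrightarrow> norm (T x - S x) \<le> \<delta> * norm x"
      using approx[OF \<delta>(1)] by blast
    have bS: "bounded_operator_on V S"
      using wc by (simp add: weakly_compact_operator_on_def)
    have "N'' (bitranspose_on T \<eta> - bitranspose_on S \<eta>) \<le> L * \<delta>"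
    proof (rule bidual_norm_least)
      fix \<phi> assume \<phi>: "\<phi> \<in> V'" "N' \<phi> \<le> 1"
      have tr: "transpose_on T \<phi> \<in> V'" "transpose_on S \<phi> \<in> V'"
        by (auto intro: transpose_in_dual T bS \<phi>)
      have "N' (transpose_on T \<phi> - transpose_on S \<phi>) \<le> \<delta>"
      proof (rule V.dual_norm_least)
        fix x assume x: "x \<in> V" "norm x \<le> 1"
        have "cmod (\<phi> (T x) - \<phi> (S x)) \<le> \<delta> * N' \<phi> * norm x"
          by (rule bounded_operator_dist[OF T bS S \<phi>(1) x(1)])
        also have "\<dots> \<le> \<delta> * 1 * 1"
          using \<delta> \<phi> x V.dual_norm_nonneg[OF \<phi>(1)] by (intro mult_mono) auto
        finally show "cmod ((transpose_on T \<phi> - transpose_on S \<phi>) x) \<le> \<delta>"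
          using x by (simp add: transpose_on_def)
      qed
      moreover have "cmod (\<eta> (transpose_on T \<phi> - transpose_on S \<phi>))
          \<le> L * N' (transpose_on T \<phi> - transpose_on S \<phi>)"
        by (intro L(2) csubspace_diff V.csubspace_dual_space tr)
      ultimately have "cmod (\<eta> (transpose_on T \<phi> - transpose_on S \<phi>)) \<le> L * \<delta>"
        using L(1) by (meson mult_left_mono order_trans)
      then show "cmod ((bitranspose_on T \<eta> - bitranspose_on S \<eta>) \<phi>) \<le> L * \<delta>"
        using \<phi> tr clinear_on_diff[OF V.csubspace_dual_space bidual_clinear[OF \<eta>] tr]
        by (simp add: bitranspose_on_def)
    qed
    moreover have "bitranspose_on S \<eta> \<in> emb ` V"
      using wc \<eta> Gantmacher[OF bS] by blast
    ultimately show "\<exists>d\<in>emb ` V. N'' (bitranspose_on T \<eta> - d) < \<epsilon>"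
      using \<delta>(2) by force
  qed
qed

text \<open>By Gantmacher's theorem \<open>T** \<eta>\<close> is \<open>emb y\<close> for some
  \<open>y\<close> in \<open>V\<close>, and \<open>S**\<close> sends \<open>emb y\<close> to
  \<open>emb (S y)\<close>.\<close>

lemma weakly_compact_compose:
  assumes S: "bounded_operator_on V S" and T: "weakly_compact_operator_on V T"
  shows "weakly_compact_operator_on V (\<lambda>x. S (T x))"
proof -
  have bT: "bounded_operator_on V T"
    using T by (simp add: weakly_compact_operator_on_def)
  have "bitranspose_on (\<lambda>x. S (T x)) \<eta> \<in> emb ` V" if "\<eta> \<in> V''" for \<eta>
  proof -
    obtain y where y: "y \<in> V" "bitranspose_on T \<eta> = emb y"
      using Gantmacher[OF bT] T \<open>\<eta> \<in> V''\<close> by blast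
    have "transpose_on T (transpose_on S \<phi>) = transpose_on (\<lambda>x. S (T x)) \<phi>" for \<phi>
      using bounded_operator_in[OF bT] by (auto simp: transpose_on_def)
    then have "bitranspose_on (\<lambda>x. S (T x)) \<eta> \<phi> = emb (S y) \<phi>" for \<phi>
      using fun_cong[OF y(2), of "transpose_on S \<phi>"] transpose_in_dual[OF S, of \<phi>] y(1)
      by (auto simp: bitranspose_on_def canonical_embedding_def transpose_on_def[of S])
    then have "bitranspose_on (\<lambda>x. S (T x)) \<eta> = emb (S y)"
      by (rule ext)
    then show ?thesis
      using bounded_operator_in[OF S y(1)] by blast
  qed
  then show ?thesis
    using Gantmacher[OF bounded_operator_compose[OF S bT]] by blast
qed

section \<open>Compact operators\<close>

text \<open>As \<open>V\<close> is closed, closure and compactness relative to \<open>V\<close>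
  agree with those in the whole space.\<close>

lemma compact_operator_on_iff:
  "compact_operator_on V T \<longleftrightarrow>
     bounded_operator_on V T \<and> compact (closure (T ` {x \<in> V. norm x \<le> 1}))"
proof (cases "bounded_operator_on V T")
  case True
  then have sub: "T ` {x \<in> V. norm x \<le> 1} \<subseteq> V"
    using bounded_operator_in by blast
  then have "closure (T ` {x \<in> V. norm x \<le> 1}) \<subseteq> V"
    by (rule closure_minimal[OF _ closed_V])
  then show ?thesis
    using True sub
    by (simp add: compact_operator_on_def closure_of_subtopology compactin_subtopology Int_absorb1)
qed (simp add: compact_operator_on_def)

lemma bounded_operator_continuous:
  assumes S: "bounded_operator_on V S"
  shows "continuous_on V S"
proof -
  obtain K where K: "K \<ge> 0" "\<And>x. x \<in> V \<Longrightarrow> norm (S x) \<le> K * norm x"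
    using bounded_operatorE[OF S] by blast
  have "K-lipschitz_on V S"
  proof (rule lipschitz_onI)
    fix x y assume xy: "x \<in> V" "y \<in> V"
    then show "dist (S x) (S y) \<le> K * dist x y"
      using K(2)[OF csubspace_diff[OF csubspace_V xy]]
      by (simp add: dist_norm clinear_on_diff[OF csubspace_V bounded_operator_clinear[OF S]])
  qed (rule K(1))
  then show ?thesis
    by (rule lipschitz_on_continuous_on)
qed

lemma compact_operator_compose:
  assumes S: "bounded_operator_on V S" and T: "compact_operator_on V T"
  shows "compact_operator_on V (\<lambda>x. S (T x))"
proof -
  define C where "C = closure (T ` {x \<in> V. norm x \<le> 1})"
  have bT: "bounded_operator_on V T" and C: "compact C"
    using T by (auto simp: compact_operator_on_iff C_def)
  have "C \<subseteq> V"
    unfolding C_def using bounded_operator_in[OF bT] by (intro closure_minimal closed_V) auto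
  then have SC: "compact (S ` C)"
    by (intro compact_continuous_image C continuous_on_subset[OF bounded_operator_continuous[OF S]])
  have "T ` {x \<in> V. norm x \<le> 1} \<subseteq> C"
    unfolding C_def by (rule closure_subset)
  then have "(\<lambda>x. S (T x)) ` {x \<in> V. norm x \<le> 1} \<subseteq> S ` C"
    by blast
  then have "closure ((\<lambda>x. S (T x)) ` {x \<in> V. norm x \<le> 1}) \<subseteq> S ` C"
    by (intro closure_minimal compact_imp_closed SC)
  then have "compact (closure ((\<lambda>x. S (T x)) ` {x \<in> V. norm x \<le> 1}))"
    using compact_Int_closed[OF SC closed_closure] by (metis Int_absorb1)
  then show ?thesis
    by (simp add: compact_operator_on_iff bounded_operator_compose S bT)
qed

text \<open>A finite net for the image of the ball under a nearby compact \<open>S\<close> is a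
  coarser net for its image under \<open>T\<close>, so the latter is totally bounded.\<close>

lemma compact_operator_limit:
  assumes T: "bounded_operator_on V T"
    and approx: "\<And>\<epsilon>. \<epsilon> > 0 \<Longrightarrow>
      \<exists>S. compact_operator_on V S \<and> (\<forall>x\<in>V. norm (T x - S x) \<le> \<epsilon> * norm x)"
  shows "compact_operator_on V T"
proof -
  define B where "B = {x \<in> V. norm x \<le> 1}"
  have "\<exists>k. finite k \<and> closure (T ` B) \<subseteq> (\<Union>x\<in>k. ball x \<epsilon>)" if \<epsilon>: "\<epsilon> > 0" for \<epsilon>
  proof -
    obtain S where S: "compact (closure (S ` B))" "\<And>x. x \<in> V \<Longrightarrow> norm (T x - S x) \<le> \<epsilon> / 3 * norm x"
      using approx[of "\<epsilon> / 3"] \<epsilon> by (auto simp: compact_operator_on_iff B_def)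
    then obtain k where k: "finite k" "closure (S ` B) \<subseteq> (\<Union>x\<in>k. ball x (\<epsilon> / 3))"
      using \<epsilon> unfolding compact_eq_totally_bounded by (metis divide_pos_pos zero_less_numeral)
    have "T x \<in> (\<Union>y\<in>k. cball y (2 * \<epsilon> / 3))" if x: "x \<in> B" for x
    proof -
      obtain y where y: "y \<in> k" "dist y (S x) < \<epsilon> / 3"
        using k(2) x closure_subset[of "S ` B"] by (auto simp: subset_iff)
      have "norm (T x - S x) \<le> \<epsilon> / 3 * norm x"
        using S(2) x by (simp add: B_def)
      also have "\<dots> \<le> \<epsilon> / 3 * 1"
        using x \<epsilon> by (intro mult_left_mono) (auto simp: B_def)
      finally have "norm (T x - S x) \<le> \<epsilon> / 3"
        by simp
      then have "dist y (T x) \<le> 2 * \<epsilon> / 3"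
        using y(2) dist_triangle[of y "T x" "S x"] by (simp add: dist_norm norm_minus_commute)
      then show ?thesis
        using y(1) by auto
    qed
    \<comment> \<open>A finite union of closed balls is closed and so contains the closure; their
      radius stays below \<epsilon>.\<close>
    then have "closure (T ` B) \<subseteq> (\<Union>y\<in>k. cball y (2 * \<epsilon> / 3))"
      using k(1) by (intro closure_minimal closed_UN) auto
    also have "\<dots> \<subseteq> (\<Union>y\<in>k. ball y \<epsilon>)"
      using \<epsilon> by (intro UN_mono) auto
    finally show ?thesis
      using k(1) by blast
  qed
  then have "compact (closure (T ` B))"
    unfolding compact_eq_totally_bounded by (simp add: complete_eq_closed)
  then show ?thesis
    using T by (simp add: compact_operator_on_iff B_def)
qed

end

section \<open>Operator algebras\<close>

lemma cinner_zero_left: "cinner 0 (y::'a::complex_hilbert) = 0"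
  using cinner_add_left[of 0 0 y] by simp

lemma cinner_zero_right: "cinner (x::'a::complex_hilbert) 0 = 0"
  using cinner_commute[of x 0] by (simp add: cinner_zero_left)

lemma cinner_add_right: "cinner (x::'a::complex_hilbert) (y + z) = cinner x y + cinner x z"
  using cinner_commute[of x "y + z"] cinner_commute[of x y] cinner_commute[of x z]
  by (simp add: cinner_add_left)

lemma cinner_scaleC_right: "cinner (x::'a::complex_hilbert) (c *\<^sub>C y) = cnj c * cinner x y"
  using cinner_commute[of x "c *\<^sub>C y"] cinner_commute[of x y]
  by (simp add: cinner_scaleC_left)

lemma cinner_self: "cinner x x = complex_of_real ((norm (x::'a::complex_hilbert))\<^sup>2)"
proof -
  have "0 \<le> Re (cinner x x)"
    using norm_ge_zero[of x] unfolding norm_eq_sqrt_cinner[of x] by simp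
  then have "(norm x)\<^sup>2 = Re (cinner x x)"
    by (simp add: norm_eq_sqrt_cinner)
  moreover have "Im (cinner x x) = 0"
    using arg_cong[OF cinner_commute[of x x], of Im] by simp
  ultimately show ?thesis
    by (simp add: complex_eq_iff)
qed

lemma Cauchy_Schwarz_cinner: "cmod (cinner x y) \<le> norm x * norm (y::'a::complex_hilbert)"
proof (cases "y = 0")
  case False
  define n where "n = (norm y)\<^sup>2"
  have n: "n > 0"
    using False by (simp add: n_def)
  define p where "p = cinner x y"
  \<comment> \<open>With this \<open>c\<close>, the vector \<open>x + c *\<^sub>C y\<close> is the
    component of \<open>x\<close> orthogonal to \<open>y\<close>.\<close>
  define c where "c = - p / complex_of_real n"
  have "complex_of_real ((norm (x + c *\<^sub>C y))\<^sup>2) =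
      complex_of_real ((norm x)\<^sup>2) + cnj c * p + c * cnj p + c * cnj c * complex_of_real n"
    using cinner_commute[of y x] unfolding n_def p_def
    by (simp add: cinner_self[symmetric] del: of_real_power) (simp add: cinner_add_left cinner_add_right cinner_scaleC_left
        cinner_scaleC_right algebra_simps)
  also have "\<dots> = complex_of_real ((norm x)\<^sup>2) - p * cnj p / complex_of_real n"
    using n by (simp add: c_def field_simps)
  also have "\<dots> = complex_of_real ((norm x)\<^sup>2 - (cmod p)\<^sup>2 / n)"
    by (simp only: complex_norm_square[symmetric] of_real_diff of_real_divide)
  finally have "(norm (x + c *\<^sub>C y))\<^sup>2 = (norm x)\<^sup>2 - (cmod p)\<^sup>2 / n"
    by (simp only: of_real_eq_iff)
  then have "(cmod p)\<^sup>2 / n \<le> (norm x)\<^sup>2"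
    by (smt (verit) zero_le_power2)
  then have "(cmod p)\<^sup>2 \<le> (norm x * norm y)\<^sup>2"
    using n by (simp add: n_def field_simps)
  then show ?thesis
    unfolding p_def by (rule power2_le_imp_le) simp
qed (simp add: cinner_zero_right)

locale operator_alg =
  fixes A :: "('h::complex_hilbert \<Rightarrow>\<^sub>L 'h) set"
  assumes operator_algebra: "operator_algebra A"
begin

lemma clinear_A: "a \<in> A \<Longrightarrow> clinear_on UNIV (blinfun_apply a)"
  and csubspace_A: "csubspace A"
  and compose_in_A: "a \<in> A \<Longrightarrow> b \<in> A \<Longrightarrow> a o\<^sub>L b \<in> A"
  and closed_A: "closed A"
  using operator_algebra by (auto simp: operator_algebra_def)

text \<open>The vector functionals \<open>y \<mapsto> \<langle>y h, k\<rangle>\<close> already norm \<open>A\<close>, so Hahn-Banach is not needed.\<close>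

lemma vector_functional:
  fixes h k :: 'h
  defines "\<phi> \<equiv> (\<lambda>y. if y \<in> A then cinner (blinfun_apply y h) k else 0)"
  shows "\<phi> \<in> dual_space A norm" "dual_norm A norm \<phi> \<le> norm h * norm k"
proof -
  interpret homogeneous_space A norm
    by standard (simp_all add: csubspace_A norm_scaleC)
  have le: "cmod (\<phi> y) \<le> norm h * norm k * norm y" if "y \<in> A" for y
  proof -
    have "cmod (\<phi> y) \<le> norm (blinfun_apply y h) * norm k"
      using that by (simp add: \<phi>_def Cauchy_Schwarz_cinner)
    also have "\<dots> \<le> (norm y * norm h) * norm k"
      by (intro mult_right_mono norm_blinfun) simp
    finally show ?thesis
      by (simp add: mult_ac)
  qed
  have "clinear_on A \<phi>"
    by (simp add: clinear_on_def \<phi>_def csubspace_add[OF csubspace_A] csubspace_scale[OF csubspace_A]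
        plus_blinfun.rep_eq scaleC_blinfun.rep_eq cinner_add_left cinner_scaleC_left scaleC_complex_def)
  then show "\<phi> \<in> dual_space A norm"
    using le by (auto simp: dual_space_def \<phi>_def)
  show "dual_norm A norm \<phi> \<le> norm h * norm k"
  proof (rule dual_norm_least)
    fix y assume "y \<in> A" "norm y \<le> 1"
    then show "cmod (\<phi> y) \<le> norm h * norm k"
      using le[of y] mult_left_mono[of "norm y" 1 "norm h * norm k"] by simp
  qed
qed

sublocale norming_subspace A
proof
  fix x K assume x: "x \<in> A" and K: "K \<ge> 0"
    and bound: "\<And>\<phi>. \<phi> \<in> dual_space A norm \<Longrightarrow> cmod (\<phi> x) \<le> K * dual_norm A norm \<phi>"
  show "norm x \<le> K"
  proof (rule norm_blinfun_bound[OF K])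
    fix h
    \<comment> \<open>Testing against the vector functional of \<open>h\<close> and
      \<open>x h\<close> itself produces the square of the norm of \<open>x h\<close>.\<close>
    let ?k = "blinfun_apply x h"
    have "cmod (cinner ?k ?k) \<le> K * (norm h * norm ?k)"
      using bound[OF vector_functional(1)[of h ?k]] x
        mult_left_mono[OF vector_functional(2)[of h ?k] K] by simp
    then have "norm ?k * norm ?k \<le> (K * norm h) * norm ?k"
      by (simp add: cinner_self power2_eq_square norm_mult mult.assoc)
    then show "norm ?k \<le> K * norm h"
      using K by (cases "?k = 0") auto
  qed
qed (fact csubspace_A closed_A)+

section \<open>Multiplication operators\<close>

lemma compose_assoc: "(x o\<^sub>L y) o\<^sub>L z = x o\<^sub>L (y o\<^sub>L z)"
  by (rule blinfun_eqI) simp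

lemma scaleC_compose_left: "(c *\<^sub>C x) o\<^sub>L y = c *\<^sub>C (x o\<^sub>L y)"
  by (rule blinfun_eqI) (simp add: scaleC_blinfun.rep_eq)

lemma scaleC_compose_right: "a \<in> A \<Longrightarrow> a o\<^sub>L (c *\<^sub>C y) = c *\<^sub>C (a o\<^sub>L y)"
  by (rule blinfun_eqI) (simp add: scaleC_blinfun.rep_eq clinear_on_scale[OF clinear_A])

lemma bounded_mult_left:
  assumes a: "a \<in> A"
  shows "bounded_operator_on A (\<lambda>x. a o\<^sub>L x)"
  unfolding bounded_operator_on_def clinear_on_def
  using a norm_blinfun_compose[of a]
  by (auto simp: compose_in_A scaleC_compose_right bounded_bilinear.add_right[OF bounded_bilinear_blinfun_compose])

lemma bounded_mult_right:
  assumes b: "b \<in> A"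
  shows "bounded_operator_on A (\<lambda>x. x o\<^sub>L b)"
  unfolding bounded_operator_on_def clinear_on_def
  using b norm_blinfun_compose[of _ b]
  by (auto intro!: exI[of _ "norm b"] simp: compose_in_A scaleC_compose_left bounded_bilinear.add_left[OF bounded_bilinear_blinfun_compose] mult.commute)

lemma bounded_two_sided_mult:
  "a \<in> A \<Longrightarrow> b \<in> A \<Longrightarrow> bounded_operator_on A (two_sided_mult a b)"
  using bounded_operator_compose[OF bounded_mult_right bounded_mult_left, of b a]
  by (simp add: two_sided_mult_def[abs_def])

section \<open>The Arens product and second transposes\<close>

abbreviation "act \<equiv> dual_act A (o\<^sub>L)"
abbreviation "biact \<equiv> bidual_act A (o\<^sub>L)"
abbreviation "arens \<equiv> arens_product A norm (o\<^sub>L)"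

text \<open>The module action is the transpose of left multiplication, so the estimates for
  transposes apply to it.\<close>

lemma act_eq: "act \<phi> a = transpose_on (\<lambda>x. a o\<^sub>L x) \<phi>"
  by (simp add: dual_act_def transpose_on_def)

lemma act_in_dual: "\<phi> \<in> V' \<Longrightarrow> a \<in> A \<Longrightarrow> act \<phi> a \<in> V'"
  by (simp add: act_eq transpose_in_dual bounded_mult_left)

lemma act_add: "\<phi> \<in> V' \<Longrightarrow> a \<in> A \<Longrightarrow> b \<in> A \<Longrightarrow> act \<phi> (a + b) = act \<phi> a + act \<phi> b"
  by (auto simp: dual_act_def fun_eq_iff bounded_bilinear.add_left[OF bounded_bilinear_blinfun_compose]
      clinear_on_add[OF dual_space_clinear] compose_in_A)

lemma act_scale: "\<phi> \<in> V' \<Longrightarrow> a \<in> A \<Longrightarrow> act \<phi> (c *\<^sub>C a) = c *\<^sub>C act \<phi> a"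
  by (auto simp: dual_act_def fun_eq_iff scaleC_fun_def scaleC_compose_left scaleC_complex_def
      clinear_on_scale[OF dual_space_clinear] compose_in_A)

lemma biact_in_dual:
  assumes \<eta>: "\<eta> \<in> V''" and \<phi>: "\<phi> \<in> V'"
  shows "biact \<eta> \<phi> \<in> V'"
proof -
  obtain L where L: "L \<ge> 0" "\<And>\<phi>. \<phi> \<in> V' \<Longrightarrow> cmod (\<eta> \<phi>) \<le> L * N' \<phi>"
    using V'.dual_space_bound[of \<eta>] \<eta> unfolding bidual_def by blast
  have "cmod (\<eta> (act \<phi> a)) \<le> (L * N' \<phi>) * norm a" if a: "a \<in> A" for a
  proof -
    have "N' (act \<phi> a) \<le> norm a * N' \<phi>"
      unfolding act_eq
      by (rule transpose_norm_le[OF _ _ bounded_mult_left[OF a] \<phi>]) (simp_all add: norm_blinfun_compose)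
    then have "L * N' (act \<phi> a) \<le> L * (norm a * N' \<phi>)"
      by (rule mult_left_mono[OF _ L(1)])
    then show ?thesis
      using L(2)[OF act_in_dual[OF \<phi> a]] by (simp add: mult_ac)
  qed
  moreover have "clinear_on A (biact \<eta> \<phi>)"
    unfolding clinear_on_def
    by (simp add: bidual_act_def csubspace_add[OF csubspace_A] csubspace_scale[OF csubspace_A]
        act_add[OF \<phi>] act_scale[OF \<phi>] clinear_on_add[OF bidual_clinear[OF \<eta>]]
        clinear_on_scale[OF bidual_clinear[OF \<eta>]] act_in_dual[OF \<phi>])
  ultimately show ?thesis
    by (auto simp: dual_space_def bidual_act_def)
qed

lemma arens_emb_left:
  assumes "a \<in> A" "\<eta> \<in> V''" "\<phi> \<in> V'"
  shows "arens (emb a) \<eta> \<phi> = \<eta> (act \<phi> a)"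
  using assms biact_in_dual[OF assms(2,3)] by (simp add: arens_product_def emb_apply bidual_act_def)

lemma biact_emb:
  assumes "b \<in> A" "\<phi> \<in> V'"
  shows "biact (emb b) \<phi> = transpose_on (\<lambda>x. x o\<^sub>L b) \<phi>"
  using assms act_in_dual by (auto simp: bidual_act_def transpose_on_def emb_apply fun_eq_iff dual_act_def)

lemma arens_emb_emb:
  assumes "a \<in> A" "b \<in> A"
  shows "arens (emb a) (emb b) = emb (a o\<^sub>L b)"
proof
  fix \<phi>
  show "arens (emb a) (emb b) \<phi> = emb (a o\<^sub>L b) \<phi>"
  proof (cases "\<phi> \<in> V'")
    case True
    then show ?thesis
      using assms act_in_dual[OF True assms(1)]
      by (simp add: arens_emb_left emb_in_bidual emb_apply) (simp add: dual_act_def)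
  qed (simp add: arens_product_def canonical_embedding_def)
qed

text \<open>This is the link between the two sides of the first equivalence: multiplying \<eta> by
  \<open>a\<close> and \<open>b\<close> in the bidual is the second transpose of
  \<open>two_sided_mult a b\<close>, to which Gantmacher's theorem applies.\<close>

lemma arens_two_sided:
  assumes a: "a \<in> A" and b: "b \<in> A" and \<eta>: "\<eta> \<in> V''"
  shows "arens (arens (emb a) \<eta>) (emb b) = bitranspose_on (two_sided_mult a b) \<eta>"
proof
  fix \<phi>
  show "arens (arens (emb a) \<eta>) (emb b) \<phi> = bitranspose_on (two_sided_mult a b) \<eta> \<phi>"
  proof (cases "\<phi> \<in> V'")
    case True
    let ?\<psi> = "transpose_on (\<lambda>x. x o\<^sub>L b) \<phi>"
    have "arens (arens (emb a) \<eta>) (emb b) \<phi> = arens (emb a) \<eta> ?\<psi>"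
      using True by (simp add: arens_product_def[of _ _ _ "arens (emb a) \<eta>"] biact_emb[OF b])
    also have "\<dots> = \<eta> (act ?\<psi> a)"
      by (intro arens_emb_left a \<eta> transpose_in_dual bounded_mult_right b True)
    also have "act ?\<psi> a = transpose_on (two_sided_mult a b) \<phi>"
      using compose_in_A[OF a] by (auto simp: dual_act_def transpose_on_def two_sided_mult_def)
    finally show ?thesis
      using True by (simp add: bitranspose_on_def)
  qed (simp add: arens_product_def bitranspose_on_def)
qed

text \<open>\<open>emb\<close> is multiplicative and contractive, so the image of the net under
  \<open>emb\<close> is again a contractive approximate identity.\<close>

lemma has_cai_emb:
  assumes "has_cai norm (o\<^sub>L) A"
  shows "has_cai N'' arens (emb ` A)"
proof -
  obtain F where F: "F \<noteq> bot" "\<forall>\<^sub>F e in F. e \<in> A \<and> norm e \<le> 1"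
    and lim: "\<And>a. a \<in> A \<Longrightarrow> ((\<lambda>e. norm ((e o\<^sub>L a) - a)) \<longlongrightarrow> 0) F"
      "\<And>a. a \<in> A \<Longrightarrow> ((\<lambda>e. norm ((a o\<^sub>L e) - a)) \<longlongrightarrow> 0) F"
    using assms unfolding has_cai_def by blast
  have nonneg: "0 \<le> N'' (emb x)" if "x \<in> A" for x
    using V'.dual_norm_nonneg emb_in_bidual[OF that] unfolding bidual_def bidual_norm_def by blast
  have "((\<lambda>e. N'' (arens (emb e) (emb a) - emb a)) \<longlongrightarrow> 0) F \<and>
      ((\<lambda>e. N'' (arens (emb a) (emb e) - emb a)) \<longlongrightarrow> 0) F" if a: "a \<in> A" for a
  proof
    have bounds: "0 \<le> N'' (emb y - emb a)" "N'' (emb y - emb a) \<le> norm (y - a)" if "y \<in> A" for y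
      using nonneg norm_emb_le csubspace_diff[OF csubspace_A that a] that a
      by (metis emb_diff)+
    have "\<forall>\<^sub>F e in F. 0 \<le> N'' (arens (emb e) (emb a) - emb a)"
      "\<forall>\<^sub>F e in F. N'' (arens (emb e) (emb a) - emb a) \<le> norm ((e o\<^sub>L a) - a)"
      using F(2) by (auto elim!: eventually_mono simp: arens_emb_emb a bounds compose_in_A)
    then show "((\<lambda>e. N'' (arens (emb e) (emb a) - emb a)) \<longlongrightarrow> 0) F"
      by (rule tendsto_sandwich[OF _ _ tendsto_const lim(1)[OF a]])
    have "\<forall>\<^sub>F e in F. 0 \<le> N'' (arens (emb a) (emb e) - emb a)"
      "\<forall>\<^sub>F e in F. N'' (arens (emb a) (emb e) - emb a) \<le> norm ((a o\<^sub>L e) - a)"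
      using F(2) by (auto elim!: eventually_mono simp: arens_emb_emb a bounds compose_in_A)
    then show "((\<lambda>e. N'' (arens (emb a) (emb e) - emb a)) \<longlongrightarrow> 0) F"
      by (rule tendsto_sandwich[OF _ _ tendsto_const lim(2)[OF a]])
  qed
  moreover have "\<forall>\<^sub>F e in F. emb e \<in> emb ` A \<and> N'' (emb e) \<le> 1"
    using F(2) by eventually_elim (auto intro: order_trans[OF norm_emb_le])
  ultimately show ?thesis
    unfolding has_cai_def using F(1)
    by (intro exI[of _ "filtermap emb F"])
      (auto simp: filtermap_bot_iff eventually_filtermap filterlim_filtermap)
qed

text \<open>The image of \<open>A\<close> is always a norm closed subalgebra of the bidual with a
  contractive approximate identity, so only the condition on products \<open>x \<eta> y\<close>
  remains; it is translated by \<open>arens_two_sided\<close> and Gantmacher's theorem.\<close>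

lemma HSA_in_bidual_iff:
  assumes cai: "has_cai norm (o\<^sub>L) A"
  shows "HSA_in_bidual A \<longleftrightarrow> (\<forall>a\<in>A. \<forall>b\<in>A. weakly_compact_operator_on A (two_sided_mult a b))"
proof -
  have "HSA_in_bidual A \<longleftrightarrow>
      (\<forall>x\<in>emb ` A. \<forall>\<eta>\<in>V''. \<forall>y\<in>emb ` A. arens (arens x \<eta>) y \<in> emb ` A)"
    unfolding HSA_in_bidual_def hereditary_subalgebra_def
    using emb_in_bidual csubspace_range_emb range_emb_closed has_cai_emb[OF cai]
    by (auto simp: arens_emb_emb compose_in_A)
  also have "\<dots> \<longleftrightarrow>
      (\<forall>a\<in>A. \<forall>b\<in>A. \<forall>\<eta>\<in>V''. bitranspose_on (two_sided_mult a b) \<eta> \<in> emb ` A)"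
    by (auto simp: arens_two_sided)
  also have "\<dots> \<longleftrightarrow> (\<forall>a\<in>A. \<forall>b\<in>A. weakly_compact_operator_on A (two_sided_mult a b))"
    by (simp add: Gantmacher bounded_two_sided_mult)
  finally show ?thesis .
qed

text \<open>One \<open>e\<close> serves for both products, because finitely many eventual properties
  hold simultaneously along a proper filter.\<close>

lemma cai_approx:
  assumes "has_cai norm (o\<^sub>L) A" "a \<in> A" "b \<in> A" "\<epsilon> > 0"
  obtains e where "e \<in> A" "norm e \<le> 1" "norm ((a o\<^sub>L e) - a) < \<epsilon>" "norm ((e o\<^sub>L b) - b) < \<epsilon>"
proof -
  obtain F where F: "F \<noteq> bot" "\<forall>\<^sub>F e in F. e \<in> A \<and> norm e \<le> 1"
    "((\<lambda>e. norm ((e o\<^sub>L b) - b)) \<longlongrightarrow> 0) F" "((\<lambda>e. norm ((a o\<^sub>L e) - a)) \<longlongrightarrow> 0) F"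
    using assms unfolding has_cai_def by blast
  have "\<forall>\<^sub>F e in F. (e \<in> A \<and> norm e \<le> 1) \<and> norm ((e o\<^sub>L b) - b) < \<epsilon> \<and> norm ((a o\<^sub>L e) - a) < \<epsilon>"
    using F(2) order_tendstoD(2)[OF F(3) assms(4)] order_tendstoD(2)[OF F(4) assms(4)]
    by eventually_elim simp
  then show thesis
    using eventually_happens'[OF F(1)] that by blast
qed

end

text \<open>\<open>P\<close> abstracts from compactness and weak compactness, so that both cases are
  proved at once.\<close>

locale closed_operator_ideal = operator_alg A for A :: "('h::complex_hilbert \<Rightarrow>\<^sub>L 'h) set" +
  fixes P :: "(('h \<Rightarrow>\<^sub>L 'h) \<Rightarrow> ('h \<Rightarrow>\<^sub>L 'h)) \<Rightarrow> bool"
  assumes cai: "has_cai norm (o\<^sub>L) A"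
    and compose: "bounded_operator_on A S \<Longrightarrow> P T \<Longrightarrow> P (\<lambda>x. S (T x))"
    and limit: "\<lbrakk>bounded_operator_on A T;
      \<And>\<epsilon>. \<epsilon> > 0 \<Longrightarrow> \<exists>S. P S \<and> (\<forall>x\<in>A. norm (T x - S x) \<le> \<epsilon> * norm x)\<rbrakk> \<Longrightarrow> P T"
begin

text \<open>\<open>M\<^bsub>a,b\<^esub>\<close> is a norm limit of the operators \<open>M\<^bsub>ae,eb\<^esub> = M\<^bsub>a,b\<^esub> M\<^bsub>e,e\<^esub>\<close>.\<close>

lemma two_sided_mult_ideal:
  assumes diag: "\<And>a. a \<in> A \<Longrightarrow> P (two_sided_mult a a)" and a: "a \<in> A" and b: "b \<in> A"
  shows "P (two_sided_mult a b)"
proof (rule limit[OF bounded_two_sided_mult[OF a b]])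
  fix \<epsilon> :: real assume \<epsilon>: "\<epsilon> > 0"
  \<comment> \<open>The errors from replacing \<open>a\<close> by \<open>ae\<close> and
    \<open>b\<close> by \<open>eb\<close> add up to at most
    \<open>\<delta> * (norm a + norm b)\<close>; the extra 1 keeps the denominator positive.\<close>
  define \<delta> where "\<delta> = \<epsilon> / (norm a + norm b + 1)"
  have pos: "norm a + norm b + 1 > 0"
    by (simp add: add_nonneg_pos)
  have \<delta>: "\<delta> > 0" "\<delta> * (norm a + norm b) \<le> \<epsilon>"
    using \<epsilon> pos by (auto simp: \<delta>_def field_simps)
  obtain e where e: "e \<in> A" "norm e \<le> 1" "norm ((a o\<^sub>L e) - a) < \<delta>" "norm ((e o\<^sub>L b) - b) < \<delta>"
    using cai_approx[OF cai a b \<delta>(1)] .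
  have "norm (two_sided_mult a b x - two_sided_mult a b (two_sided_mult e e x)) \<le> \<epsilon> * norm x" for x
  proof -
    have le: "norm (u o\<^sub>L x o\<^sub>L v) \<le> norm u * norm v * norm x" for u v :: "'h \<Rightarrow>\<^sub>L 'h"
    proof -
      have "norm (u o\<^sub>L x o\<^sub>L v) \<le> norm (u o\<^sub>L x) * norm v"
        by (rule norm_blinfun_compose)
      also have "\<dots> \<le> (norm u * norm x) * norm v"
        by (intro mult_right_mono norm_blinfun_compose) simp
      finally show ?thesis
        by (simp add: mult_ac)
    qed
    have ae: "norm (a o\<^sub>L e) \<le> norm a"
      using norm_blinfun_compose[of a e] mult_left_mono[OF e(2), of "norm a"] by simp
    \<comment> \<open>One factor is changed at a time, first \<open>a\<close> to \<open>ae\<close>,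
      then \<open>b\<close> to \<open>eb\<close>.\<close>
    have "two_sided_mult a b x - two_sided_mult a b (two_sided_mult e e x) =
        - (((a o\<^sub>L e) - a) o\<^sub>L x o\<^sub>L b) - ((a o\<^sub>L e) o\<^sub>L x o\<^sub>L ((e o\<^sub>L b) - b))"
      by (simp add: two_sided_mult_def bounded_bilinear.diff_left[OF bounded_bilinear_blinfun_compose] bounded_bilinear.diff_right[OF bounded_bilinear_blinfun_compose]
          compose_assoc)
    also have "norm \<dots> \<le> norm (((a o\<^sub>L e) - a) o\<^sub>L x o\<^sub>L b) + norm ((a o\<^sub>L e) o\<^sub>L x o\<^sub>L ((e o\<^sub>L b) - b))"
      by (metis norm_minus_cancel norm_triangle_ineq4)
    also have "\<dots> \<le> \<delta> * norm b * norm x + norm a * \<delta> * norm x"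
      using e \<delta>(1) ae by (intro add_mono order_trans[OF le] mult_right_mono mult_mono) auto
    also have "\<dots> = \<delta> * (norm a + norm b) * norm x"
      by (simp add: algebra_simps)
    also have "\<dots> \<le> \<epsilon> * norm x"
      by (intro mult_right_mono \<delta>) simp
    finally show ?thesis .
  qed
  then show "\<exists>S. P S \<and> (\<forall>x\<in>A. norm (two_sided_mult a b x - S x) \<le> \<epsilon> * norm x)"
    using compose[OF bounded_two_sided_mult[OF a b] diag[OF e(1)]] by blast
qed

lemma mult_left_ideal_iff:
  assumes comm: "\<And>a b. a \<in> A \<Longrightarrow> b \<in> A \<Longrightarrow> a o\<^sub>L b = b o\<^sub>L a"
  shows "(\<forall>a\<in>A. P (two_sided_mult a a)) \<longleftrightarrow> (\<forall>a\<in>A. P (\<lambda>x. a o\<^sub>L x))"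
proof (intro iffI ballI)
  fix a assume P: "\<forall>a\<in>A. P (two_sided_mult a a)" and a: "a \<in> A"
  show "P (\<lambda>x. a o\<^sub>L x)"
  proof (rule limit[OF bounded_mult_left[OF a]])
    fix \<epsilon> :: real assume "\<epsilon> > 0"
    then obtain e where e: "e \<in> A" "norm ((e o\<^sub>L a) - a) < \<epsilon>"
      using cai_approx[OF cai a a] by metis
    have "norm ((a o\<^sub>L x) - two_sided_mult e a x) \<le> \<epsilon> * norm x" if x: "x \<in> A" for x
    proof -
      \<comment> \<open>Commutativity turns \<open>exa\<close> into \<open>(ea)x\<close>, so the
        error is multiplication by \<open>a - ea\<close>, which is small.\<close>
      have "two_sided_mult e a x = (e o\<^sub>L a) o\<^sub>L x"
        using comm[OF a x] by (simp add: two_sided_mult_def compose_assoc)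
      then have "(a o\<^sub>L x) - two_sided_mult e a x = (a - (e o\<^sub>L a)) o\<^sub>L x"
        by (simp add: bounded_bilinear.diff_left[OF bounded_bilinear_blinfun_compose])
      also have "norm \<dots> \<le> norm (a - (e o\<^sub>L a)) * norm x"
        by (rule norm_blinfun_compose)
      also have "\<dots> \<le> \<epsilon> * norm x"
        using e(2) by (intro mult_right_mono) (simp_all add: norm_minus_commute)
      finally show ?thesis .
    qed
    then show "\<exists>S. P S \<and> (\<forall>x\<in>A. norm ((a o\<^sub>L x) - S x) \<le> \<epsilon> * norm x)"
      using two_sided_mult_ideal[OF _ e(1) a] P by blast
  qed
next
  fix a assume P: "\<forall>a\<in>A. P (\<lambda>x. a o\<^sub>L x)" and a: "a \<in> A"
  have "two_sided_mult a a x = (a o\<^sub>L a) o\<^sub>L x" if "x \<in> A" for x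
    using comm[OF a that] unfolding two_sided_mult_def compose_assoc by simp
  \<comment> \<open>The two operators agree on \<open>A\<close> but may differ as functions off
    \<open>A\<close>; \<open>limit\<close> with error 0 carries \<open>P\<close> from one to the
    other.\<close>
  then show "P (two_sided_mult a a)"
    using P compose_in_A[OF a a]
    by (intro limit[OF bounded_two_sided_mult[OF a a]] exI[of _ "\<lambda>x. (a o\<^sub>L a) o\<^sub>L x"]) simp
qed

end

theorem lemma5p1:
  fixes A :: "('h::complex_hilbert \<Rightarrow>\<^sub>L 'h) set"
  assumes "operator_algebra A"
    and "has_cai norm (o\<^sub>L) A"
  shows
    "(HSA_in_bidual A \<longleftrightarrow> (\<forall>a\<in>A. \<forall>b\<in>A. weakly_compact_operator_on A (two_sided_mult a b))) \<and>
     ((\<forall>a\<in>A. \<forall>b\<in>A. weakly_compact_operator_on A (two_sided_mult a b)) \<longleftrightarrow>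
       weakly_compact_algebra A) \<and>
     ((\<forall>a\<in>A. \<forall>b\<in>A. compact_operator_on A (two_sided_mult a b)) \<longleftrightarrow> compact_algebra A) \<and>
     ((\<forall>a\<in>A. \<forall>b\<in>A. a o\<^sub>L b = b o\<^sub>L a) \<longrightarrow>
       (compact_algebra A \<longleftrightarrow> (\<forall>a\<in>A. compact_operator_on A (\<lambda>x. a o\<^sub>L x))) \<and>
       (weakly_compact_algebra A \<longleftrightarrow> (\<forall>a\<in>A. weakly_compact_operator_on A (\<lambda>x. a o\<^sub>L x))))"
proof -
  interpret operator_alg A
    by standard (rule assms(1))
  interpret wc: closed_operator_ideal A "weakly_compact_operator_on A"
    by standard (fact assms(2) weakly_compact_compose weakly_compact_limit)+
  interpret cpt: closed_operator_ideal A "compact_operator_on A"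
    by standard (fact assms(2) compact_operator_compose compact_operator_limit)+
  show ?thesis
    unfolding weakly_compact_algebra_def compact_algebra_def
    using HSA_in_bidual_iff[OF assms(2)] wc.two_sided_mult_ideal cpt.two_sided_mult_ideal
      wc.mult_left_ideal_iff cpt.mult_left_ideal_iff
    by blast
qed

end
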